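(* Let $N\ge2$, $i\in\{1,\dots,N-1\}$, $p>1$, $C>0$, $R>0$ and $\gamma>0$, and let $B_R\subset\mathbb{R}^N$ be the open ball of radius $R$ centered at $0$. Consider the Dirichlet problems $$(\mathrm{DP}_0)\quad -\lambda_i(D^2u)+|Du|^p=-C\ \text{ in }B_R,\qquad u=0\ \text{ on }\partial B_R,$$ $$(\mathrm{DP}_\gamma)\quad -\lambda_i(D^2u)+|Du|^p+\gamma u=-C\ \text{ in }B_R,\qquad u=0\ \text{ on }\partial B_R.$$ Then $(\mathrm{DP}_0)$ admits a solution if and only if $(\mathrm{DP}_\gamma)$ admits a solution. Moreover, the solutions to both $(\mathrm{DP}_0)$ and $(\mathrm{DP}_\gamma)$ are unique, and they exist if and only if $$R\le \bar R:=\frac{(p-1)^{\frac{p-1}{p}}}{p\,C^{\frac{p-1}{p}}}.$$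
   Context: For a real symmetric $N\times N$ matrix $X$, $\lambda_1(X)\le\dots\le\lambda_N(X)$ denote its eigenvalues in nondecreasing order. Solutions of the Dirichlet problems are functions $u\in C(\overline{B_R})$ that vanish on $\partial B_R$ and are viscosity solutions of the equation in $B_R$. For $\gamma\ge0$ and continuous $f$, an upper (lower) semicontinuous $u$ is a viscosity subsolution (supersolution) of $-\lambda_i(D^2u)+|Du|^p+\gamma u=f$ in an open set $\Omega$ if, whenever $\varphi$ is $C^2$ and $u-\varphi$ has a local maximum (minimum) at $x\in\Omega$, one has $-\lambda_i(D^2\varphi(x))+|D\varphi(x)|^p+\gamma u(x)\le f(x)$ (respectively $\ge f(x)$); a viscosity solution is a continuous function that is both. *)

theory Defs
  imports
    "HOL-Analysis.Analysis"
    "HOL-Computational_Algebra.Polynomial"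
    "HOL-Library.Multiset"
begin

definition charpoly :: "real^'n^'n \<Rightarrow> real poly" where
  "charpoly X = det (mat [:0, 1:] - (\<chi> k l. [:X $ k $ l:]))"

text \<open>For symmetric \<open>X\<close> the list below has length \<open>CARD('n)\<close>, since all roots of the
  characteristic polynomial are real and each is repeated according to its multiplicity.
  The index of \<open>eigval\<close> starts at 1.\<close>

definition sorted_eigvals :: "real^'n^'n \<Rightarrow> real list" where
  "sorted_eigvals X = sorted_list_of_multiset (proots (charpoly X))"

definition eigval :: "nat \<Rightarrow> real^'n^'n \<Rightarrow> real" where
  "eigval i X = sorted_eigvals X ! (i - 1)"

definition gradient :: "(real^'n \<Rightarrow> real) \<Rightarrow> real^'n \<Rightarrow> real^'n" where
  "gradient f x = (THE D. GDERIV f x :> D)"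

definition hessian :: "(real^'n \<Rightarrow> real) \<Rightarrow> real^'n \<Rightarrow> real^'n^'n" where
  "hessian f x = jacobian (gradient f) (at x)"

text \<open>The derivatives are full ones, so this is meant for open \<open>S\<close>.\<close>

definition C2_on :: "(real^'n) set \<Rightarrow> (real^'n \<Rightarrow> real) \<Rightarrow> bool" where
  "C2_on S f \<longleftrightarrow> (\<forall>x\<in>S. f differentiable at x) \<and>
     (\<forall>x\<in>S. gradient f differentiable at x) \<and> continuous_on S (hessian f)"

definition usc_on :: "'a::topological_space set \<Rightarrow> ('a \<Rightarrow> real) \<Rightarrow> bool" where
  "usc_on S u \<longleftrightarrow> (\<forall>x\<in>S. \<forall>a > u x. \<forall>\<^sub>F y in at x within S. u y < a)"

definition lsc_on :: "'a::topological_space set \<Rightarrow> ('a \<Rightarrow> real) \<Rightarrow> bool" where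
  "lsc_on S u \<longleftrightarrow> (\<forall>x\<in>S. \<forall>a < u x. \<forall>\<^sub>F y in at x within S. a < u y)"

definition local_max_on :: "'a::topological_space set \<Rightarrow> ('a \<Rightarrow> real) \<Rightarrow> 'a \<Rightarrow> bool" where
  "local_max_on S w x \<longleftrightarrow> x \<in> S \<and> (\<forall>\<^sub>F y in at x within S. w y \<le> w x)"

definition local_min_on :: "'a::topological_space set \<Rightarrow> ('a \<Rightarrow> real) \<Rightarrow> 'a \<Rightarrow> bool" where
  "local_min_on S w x \<longleftrightarrow> x \<in> S \<and> (\<forall>\<^sub>F y in at x within S. w x \<le> w y)"

text \<open>Viscosity sub- and supersolutions of
  \<open>- \<lambda>\<^sub>i(D\<^sup>2u) + |Du|\<^sup>p + \<gamma> u = f\<close> in the open set \<open>\<Omega>\<close>; the values of \<open>u\<close> off \<open>\<Omega>\<close> are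
  irrelevant.\<close>

definition visc_subsolution ::
  "nat \<Rightarrow> real \<Rightarrow> real \<Rightarrow> (real^'n \<Rightarrow> real) \<Rightarrow> (real^'n) set \<Rightarrow> (real^'n \<Rightarrow> real) \<Rightarrow> bool" where
  "visc_subsolution i p \<gamma> f \<Omega> u \<longleftrightarrow> usc_on \<Omega> u \<and>
     (\<forall>\<phi> x. C2_on \<Omega> \<phi> \<and> local_max_on \<Omega> (\<lambda>y. u y - \<phi> y) x \<longrightarrow>
        - eigval i (hessian \<phi> x) + norm (gradient \<phi> x) powr p + \<gamma> * u x \<le> f x)"

definition visc_supersolution ::
  "nat \<Rightarrow> real \<Rightarrow> real \<Rightarrow> (real^'n \<Rightarrow> real) \<Rightarrow> (real^'n) set \<Rightarrow> (real^'n \<Rightarrow> real) \<Rightarrow> bool" where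
  "visc_supersolution i p \<gamma> f \<Omega> u \<longleftrightarrow> lsc_on \<Omega> u \<and>
     (\<forall>\<phi> x. C2_on \<Omega> \<phi> \<and> local_min_on \<Omega> (\<lambda>y. u y - \<phi> y) x \<longrightarrow>
        - eigval i (hessian \<phi> x) + norm (gradient \<phi> x) powr p + \<gamma> * u x \<ge> f x)"

definition visc_solution ::
  "nat \<Rightarrow> real \<Rightarrow> real \<Rightarrow> (real^'n \<Rightarrow> real) \<Rightarrow> (real^'n) set \<Rightarrow> (real^'n \<Rightarrow> real) \<Rightarrow> bool" where
  "visc_solution i p \<gamma> f \<Omega> u \<longleftrightarrow>
     continuous_on \<Omega> u \<and> visc_subsolution i p \<gamma> f \<Omega> u \<and> visc_supersolution i p \<gamma> f \<Omega> u"

text \<open>Functions on the closed ball are represented by total functions, of which only the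
  restriction to the closed ball matters.\<close>

definition solves_DP :: "nat \<Rightarrow> real \<Rightarrow> real \<Rightarrow> real \<Rightarrow> real \<Rightarrow> (real^'n \<Rightarrow> real) \<Rightarrow> bool" where
  "solves_DP i p C R \<gamma> u \<longleftrightarrow> continuous_on (cball 0 R) u \<and> (\<forall>x\<in>sphere 0 R. u x = 0) \<and>
     visc_solution i p \<gamma> (\<lambda>_. - C) (ball 0 R) u"

end

theory Submission
  imports Defs "HOL-Complex_Analysis.Great_Picard"
begin

text \<open>
In the variable \<open>s = |x|\<^sup>2\<close> a radial function \<open>u(x) = H(s)\<close> has, with \<open>q = 2 H'\<close>,
gradient \<open>q x\<close> and Hessian \<open>q I + 4 H'' x \<otimes> x\<close>.  The eigenvalue \<open>q\<close> has multiplicity at least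
\<open>N - 1\<close>, so for \<open>i \<le> N - 1\<close> always \<open>\<lambda>\<^sub>i \<le> q\<close>, with equality if \<open>H\<close> is convex.  For convex
profiles the equation thus loses its second-order part and becomes
\<open>q = (q \<surd>s)\<^sup>p + \<gamma> H + C\<close>, an implicit first-order ODE, to be solved with \<open>H(R\<^sup>2) = 0\<close>.

The algebraic equation \<open>q - (r q)\<^sup>p = C\<close> has a root \<open>q \<ge> 0\<close> iff \<open>r \<le> Rbar\<close>; at \<open>r = Rbar\<close> it has
the double root \<open>b = p C / (p - 1)\<close>, and \<open>r \<le> Rbar\<close> is equivalent to \<open>(r b)\<^sup>p \<le> C / (p - 1)\<close>
(\<open>critical_radius_iff\<close>), the form used throughout.  If \<open>R \<le> Rbar\<close>, the smaller root depends
continuously on \<open>r \<in> [0, R]\<close> and on the right-hand side in \<open>[0, C]\<close>, so Peano's theorem, run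
from \<open>s = R\<^sup>2\<close> down to \<open>s = 0\<close>, yields a profile (\<open>radial_profile_exists\<close>).  The smaller root
is monotone in all its data, which makes \<open>q\<close> nondecreasing, that is, \<open>H\<close> convex.  Convexity
in \<open>s\<close> and differentiability of \<open>H\<close> are all that is needed to check that \<open>H(|x|\<^sup>2)\<close> is a
viscosity solution: from below it is touched at each point by the paraboloid of opening \<open>q\<close>,
and along tangential directions it grows no faster than that paraboloid.

Every solution \<open>v\<close> coincides with it.  Lower bound: where \<open>v - u\<close> is minimal, the
paraboloid below \<open>u\<close> also touches \<open>v\<close>, and comparing the two equations decides.  Upper bound:
to get by without second derivatives of \<open>H\<close>, \<open>v(x) - H(s)\<close> is maximised in separate variables
\<open>x, s\<close> under the penalty \<open>K (|x|\<^sup>2 - s)\<^sup>2\<close>; the test function in \<open>x\<close> is then a polynomial and stationarity in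
\<open>s\<close> identifies its radial slope with \<open>q(s)\<close> (\<open>subsolution_doubling\<close>).  For \<open>\<gamma> > 0\<close> the zeroth
order term gives the contradiction; for \<open>\<gamma> = 0\<close> the comparison is made with \<open>\<kappa> u\<close>, \<open>\<kappa> \<noteq> 1\<close>,
which is a strict sub- or supersolution because \<open>|Du|\<^sup>p < C / (p - 1)\<close> inside the ball.

If \<open>R > Rbar\<close>, then near the boundary, where \<open>v\<close> is small, no slope \<open>t\<close> satisfies
\<open>t \<ge> (|t| |x|)\<^sup>p + \<gamma> v + C\<close>; but a large multiple of \<open>(|y|\<^sup>2 - \<beta>)\<^sup>2\<close> forces a contact point there and
produces such a \<open>t\<close> (\<open>no_subsolution_supercritical\<close>).
\<close>

section \<open>Eigenvalues of symmetric matrices\<close>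

lemma symmetric_matrix_inner:
  fixes A :: "real^'n^'n"
  assumes "transpose A = A"
  shows "x \<bullet> (A *v y) = (A *v x) \<bullet> y"
  by (metis assms dot_lmul_matrix vector_transpose_matrix)

text \<open>
The eigenvector maximises the Rayleigh quotient on the unit sphere of \<open>S\<close>.  The residual
\<open>w = c x - A x\<close> lies in \<open>S\<close>, so the first variation in the direction \<open>w\<close> must vanish, which
says \<open>w \<bullet> w = 0\<close>.
\<close>

lemma symmetric_matrix_eigenvector_in_invariant_subspace:
  fixes A :: "real^'n^'n"
  assumes sym: "transpose A = A" and S: "subspace S" "S \<noteq> {0}"
    and inv: "\<And>x. x \<in> S \<Longrightarrow> A *v x \<in> S"
  obtains x c where "x \<in> S" "norm x = 1" "A *v x = c *\<^sub>R x"
proof -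
  let ?K = "S \<inter> sphere 0 1"
  let ?f = "\<lambda>x. x \<bullet> (A *v x)"
  obtain z where z: "z \<in> S" "z \<noteq> 0"
    using S subspace_0 by blast
  then have "z /\<^sub>R norm z \<in> ?K"
    using S by (auto simp: subspace_scale)
  then have "?K \<noteq> {}" by blast
  moreover have "compact ?K"
    using S closed_subspace by (metis Int_commute compact_Int_closed compact_sphere)
  moreover have "continuous_on ?K ?f"
    by (intro continuous_intros matrix_vector_mult_linear_continuous_on)
  ultimately obtain x where x: "x \<in> ?K" and max: "\<And>y. y \<in> ?K \<Longrightarrow> ?f y \<le> ?f x"
    using continuous_attains_sup[of ?K ?f] by blast
  define c where "c = ?f x"
  have le: "?f y \<le> c * (y \<bullet> y)" if "y \<in> S" for y
  proof (cases "y = 0")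
    case False
    have "y /\<^sub>R norm y \<in> ?K"
      using S that False by (auto simp: subspace_scale)
    from max[OF this] have "?f y / (norm y)\<^sup>2 \<le> c"
      by (simp add: c_def matrix_vector_mult_scaleR power2_eq_square divide_simps)
    then show ?thesis using False
      by (simp add: divide_simps power2_norm_eq_inner)
  qed simp
  define w where "w = c *\<^sub>R x - A *v x"
  define B where "B = (\<lambda>y. c * (y \<bullet> y) - ?f y)"
  have wS: "w \<in> S"
    using x inv S by (auto simp: w_def intro!: subspace_diff subspace_scale)
  have xx: "x \<bullet> x = 1" using x by (simp add: norm_eq_1)
  have exp: "B (x + t *\<^sub>R w) = 2 * t * (w \<bullet> w) + t\<^sup>2 * B w" for t
  proof -
    have "x \<bullet> (A *v w) = (A *v x) \<bullet> w" by (rule symmetric_matrix_inner[OF sym])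
    moreover have Ax: "A *v x = c *\<^sub>R x - w" by (simp add: w_def)
    moreover have "w \<bullet> x = 0"
      unfolding w_def using xx by (simp add: inner_diff_left inner_commute[of "A *v x"] c_def)
    ultimately show ?thesis using xx unfolding B_def
      by (simp only: matrix_vector_right_distrib matrix_vector_mult_scaleR Ax) (simp add: matrix_vector_right_distrib matrix_vector_mult_scaleR inner_add_left inner_add_right
          inner_diff_left inner_diff_right inner_commute algebra_simps power2_eq_square c_def[symmetric])
  qed
  have nonneg: "0 \<le> 2 * t * (w \<bullet> w) + t\<^sup>2 * B w" for t
    using le[of "x + t *\<^sub>R w"] x wS S exp[of t] by (auto simp: B_def subspace_add subspace_scale)
  have "w \<bullet> w = 0"
  proof (cases "B w = 0")
    case True
    then have "0 \<le> - 2 * (w \<bullet> w)" using nonneg[of "-1"] by simp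
    then show ?thesis using inner_ge_zero[of w] by linarith
  next
    case False
    then have "B w > 0" using le[OF wS] by (simp add: B_def)
    then have "0 \<le> - (w \<bullet> w)\<^sup>2 / B w"
      using nonneg[of "- (w \<bullet> w) / B w"] by (simp add: field_simps power2_eq_square)
    then show ?thesis using \<open>B w > 0\<close>
      by (simp add: divide_simps)
  qed
  then have "A *v x = c *\<^sub>R x" by (simp add: w_def)
  then show ?thesis using x that by auto
qed

text \<open>
By symmetry the orthogonal complement of an eigenvector in \<open>S\<close> is again invariant, so one
eigenvector after the other can be split off.
\<close>

lemma symmetric_matrix_orthonormal_eigenvectors:
  fixes A :: "real^'n^'n"
  assumes sym: "transpose A = A" and "subspace S" and "\<And>x. x \<in> S \<Longrightarrow> A *v x \<in> S"
  shows "\<exists>B \<subseteq> S. finite B \<and> card B = dim S \<and> pairwise orthogonal B \<and>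
           (\<forall>x\<in>B. norm x = 1 \<and> (\<exists>c. A *v x = c *\<^sub>R x))"
  using assms(2,3)
proof (induction "dim S" arbitrary: S)
  case 0
  then show ?case by (intro exI[of _ "{}"]) auto
next
  case (Suc n)
  then have "S \<noteq> {0}" by (metis dim_singleton nat.simps(3))
  then obtain x c where x: "x \<in> S" "norm x = 1" "A *v x = c *\<^sub>R x"
    using symmetric_matrix_eigenvector_in_invariant_subspace[OF sym Suc.prems(1)] Suc.prems(2) by blast
  let ?T = "{y \<in> S. \<forall>z \<in> span {x}. orthogonal z y}"
  have T_eq: "?T = {y \<in> S. x \<bullet> y = 0}"
    by (auto simp: span_singleton orthogonal_def)
  have "dim ?T + dim (span {x}) = dim S"
    using x Suc.prems(1) by (intro dim_subspace_orthogonal_to_vectors) (auto simp: span_minimal)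
  moreover have "dim (span {x}) = 1" using x by (auto simp: dim_singleton)
  ultimately have dim: "n = dim ?T" using Suc.hyps by simp
  have subT: "subspace ?T"
    unfolding T_eq using Suc.prems(1)
    by (auto simp: subspace_def inner_add_right)
  have invT: "A *v y \<in> ?T" if "y \<in> ?T" for y
  proof -
    have "x \<bullet> (A *v y) = (A *v x) \<bullet> y" by (rule symmetric_matrix_inner[OF sym])
    then show ?thesis using that Suc.prems(2) x unfolding T_eq by simp
  qed
  obtain B where B: "B \<subseteq> ?T" "finite B" "card B = n" "pairwise orthogonal B"
      "\<forall>x\<in>B. norm x = 1 \<and> (\<exists>c. A *v x = c *\<^sub>R x)"
    using Suc.hyps(1)[OF dim subT invT] dim by auto
  have "x \<notin> B" using B(1) x unfolding T_eq by auto
  moreover have "pairwise orthogonal (insert x B)"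
    using B(1,4) unfolding T_eq by (auto simp: pairwise_insert orthogonal_def inner_commute)
  ultimately show ?case
    using B x Suc.hyps(2) by (intro exI[of _ "insert x B"]) auto
qed

text \<open>
The spectral theorem, in the form that fits the definition of the eigenvalues as roots with
multiplicity.  With the eigenvectors as columns of \<open>P\<close>, the identity \<open>(X - A) P = P D\<close> holds
between matrices of polynomials, and \<open>det P\<close> is a nonzero constant that cancels.
\<close>

lemma symmetric_matrix_spectral:
  fixes A :: "real^'n^'n"
  assumes sym: "transpose A = A"
  obtains b :: "'n \<Rightarrow> real^'n" and d :: "'n \<Rightarrow> real"
  where "\<And>j k. b j \<bullet> b k = (if j = k then 1 else 0)"
    and "\<And>j. A *v b j = d j *\<^sub>R b j"
    and "proots (charpoly A) = image_mset d (mset_set UNIV)"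
proof -
  obtain B where B: "finite B" "card B = CARD('n)" "pairwise orthogonal B"
      "\<forall>x\<in>B. norm x = 1 \<and> (\<exists>c. A *v x = c *\<^sub>R x)"
    using symmetric_matrix_orthonormal_eigenvectors[OF sym subspace_UNIV]
    by (auto simp: dim_UNIV)
  then obtain b where b: "bij_betw b (UNIV :: 'n set) B"
    using finite_same_card_bij[of "UNIV :: 'n set" B] by auto
  then have bB: "b j \<in> B" for j by (auto simp: bij_betw_def)
  then have "\<forall>j. \<exists>c. A *v b j = c *\<^sub>R b j" using B(4) by blast
  from choice[OF this] obtain d where d: "A *v b j = d j *\<^sub>R b j" for j by blast
  have orth: "b j \<bullet> b k = (if j = k then 1 else 0)" for j k
  proof (cases "j = k")
    case True
    then show ?thesis using B(4) bB by (auto simp: norm_eq_1)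
  next
    case False
    then have "b j \<noteq> b k" using b by (auto simp: bij_betw_def inj_on_def)
    then show ?thesis using False B(3) bB by (auto simp: pairwise_def orthogonal_def)
  qed
  define P :: "real poly^'n^'n" where "P = (\<chi> k l. [:b l $ k:])"
  define X :: "real poly^'n^'n" where "X = mat [:0, 1:]"
  define D :: "real poly^'n^'n" where "D = (\<chi> k l. if k = l then [:- d k, 1:] else 0)"
  define A' :: "real poly^'n^'n" where "A' = (\<chi> k l. [:A $ k $ l:])"
  have const_sum: "(\<Sum>x\<in>S. [:f x:]) = [:sum f S:]" for f :: "'n \<Rightarrow> real" and S
    by (induction S rule: infinite_finite_induct) auto
  have "transpose P ** P = mat 1"
    using orth by (simp add: vec_eq_iff matrix_matrix_mult_def transpose_def P_def mat_def
        const_sum inner_vec_def pCons_one)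
  then have "det P * det P = 1"
    by (metis det_I det_mul det_transpose)
  then have det: "det P \<noteq> 0" by auto
  have Ab: "(\<Sum>m\<in>UNIV. A $ k $ m * b l $ m) = d l * b l $ k" for k l
    using arg_cong[OF d[of l], of "\<lambda>v. v $ k"] by (simp add: matrix_vector_mult_def)
  have "(X - A') ** P = P ** D"
  proof -
    have "((X - A') ** P) $ k $ l = (P ** D) $ k $ l" for k l
    proof -
      have "((X - A') ** P) $ k $ l =
          (\<Sum>m\<in>UNIV. (if k = m then [:0, 1:] else 0) * [:b l $ m:]) - (\<Sum>m\<in>UNIV. [:A $ k $ m * b l $ m:])"
        by (simp add: matrix_matrix_mult_def X_def A'_def P_def mat_def smult_diff_right
            sum_subtractf mult.commute)
      also have "\<dots> = [:0, 1:] * [:b l $ k:] - [:d l * b l $ k:]"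
        by (simp add: const_sum Ab if_distrib[of "smult c" for c] cong: if_cong)
      also have "\<dots> = [:b l $ k:] * [:- d l, 1:]" by (simp add: mult.commute)
      also have "\<dots> = (\<Sum>m\<in>UNIV. [:b m $ k:] * (if m = l then [:- d m, 1:] else 0))"
        by (simp add: if_distrib[of "smult c" for c] cong: if_cong)
      also have "\<dots> = (P ** D) $ k $ l"
        by (simp add: matrix_matrix_mult_def P_def D_def)
      finally show ?thesis .
    qed
    then show ?thesis by (simp add: vec_eq_iff)
  qed
  then have "det (X - A') * det P = det P * det D"
    by (metis det_mul)
  then have "charpoly A = det D"
    using det by (simp add: charpoly_def X_def A'_def mult.commute)
  also have "\<dots> = (\<Prod>k\<in>UNIV. [:- d k, 1:])"
    by (subst det_diagonal) (auto simp: D_def)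
  finally have "proots (charpoly A) = (\<Sum>k\<in>UNIV. {#d k#})"
    by (simp add: proots_prod)
  also have "\<dots> = image_mset d (mset_set UNIV)"
    by (simp add: sum_unfold_sum_mset sum_mset_singleton_mset image_mset.compositionality o_def)
  finally show ?thesis using that[of b d] orth d by blast
qed

lemma length_sorted_eigvals:
  fixes A :: "real^'n^'n"
  assumes sym: "transpose A = A"
  shows "length (sorted_eigvals A) = CARD('n)"
proof -
  obtain b d where "proots (charpoly A) = image_mset d (mset_set (UNIV :: 'n set))"
    using symmetric_matrix_spectral[OF sym] by metis
  then show ?thesis unfolding sorted_eigvals_def
    by (metis mset_sorted_list_of_multiset size_mset size_image_mset size_mset_set)
qed

lemma eigval_ge:
  fixes A :: "real^'n^'n"
  assumes sym: "transpose A = A" and i: "1 \<le> i" "i \<le> CARD('n)"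
    and ge: "\<And>x. c * (x \<bullet> x) \<le> x \<bullet> (A *v x)"
  shows "c \<le> eigval i A"
proof -
  obtain b d where b: "\<And>j k :: 'n. b j \<bullet> b k = (if j = k then 1 else 0)"
    and d: "\<And>j. A *v b j = d j *\<^sub>R b j"
    and pr: "proots (charpoly A) = image_mset d (mset_set (UNIV :: 'n set))"
    using symmetric_matrix_spectral[OF sym] by metis
  have "eigval i A \<in> set (sorted_eigvals A)"
    unfolding eigval_def using i by (intro nth_mem) (simp add: length_sorted_eigvals[OF sym])
  then have "eigval i A \<in># proots (charpoly A)"
    by (simp add: sorted_eigvals_def)
  then obtain j where "eigval i A = d j" using pr by auto
  then show ?thesis using ge[of "b j"] by (simp add: b d)
qed

text \<open>
If \<open>\<lambda>\<^sub>i > c\<close> with \<open>i < N\<close>, then two orthogonal eigenvectors have eigenvalues above \<open>c\<close>, and their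
span meets the hyperplane orthogonal to \<open>a\<close> in a nonzero vector.  In all applications \<open>a\<close> is
the radial direction.
\<close>

lemma eigval_le:
  fixes A :: "real^'n^'n"
  assumes sym: "transpose A = A" and i: "1 \<le> i" "i < CARD('n)"
    and le: "\<And>x. x \<bullet> a = 0 \<Longrightarrow> x \<bullet> (A *v x) \<le> c * (x \<bullet> x)"
  shows "eigval i A \<le> c"
proof (rule ccontr)
  assume "\<not> eigval i A \<le> c"
  then have gt: "c < sorted_eigvals A ! (i - 1)" by (simp add: eigval_def)
  obtain b d where b: "\<And>j k :: 'n. b j \<bullet> b k = (if j = k then 1 else 0)"
    and d: "\<And>j. A *v b j = d j *\<^sub>R b j"
    and pr: "proots (charpoly A) = image_mset d (mset_set (UNIV :: 'n set))"
    using symmetric_matrix_spectral[OF sym] by metis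
  let ?xs = "sorted_eigvals A"
  have len: "length ?xs = CARD('n)" by (rule length_sorted_eigvals[OF sym])
  have "sorted ?xs" by (simp add: sorted_eigvals_def)
  have "c < x" if "x \<in> set (drop (i - 1) ?xs)" for x
  proof -
    from that have "\<exists>m < length (drop (i - 1) ?xs). drop (i - 1) ?xs ! m = x"
      by (rule iffD1[OF in_set_conv_nth])
    then obtain m where m: "m < length (drop (i - 1) ?xs)" "drop (i - 1) ?xs ! m = x"
      by blast
    have "?xs ! (i - 1) \<le> ?xs ! (i - 1 + m)"
      by (rule sorted_nth_mono[OF \<open>sorted ?xs\<close>]) (use m in auto)
    then show ?thesis using m gt by simp
  qed
  then have "filter_mset (\<lambda>x. c < x) (mset (drop (i - 1) ?xs)) = mset (drop (i - 1) ?xs)"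
    by (simp add: filter_mset_eq_conv)
  moreover have "mset ?xs = mset (take (i - 1) ?xs) + mset (drop (i - 1) ?xs)"
    by (metis append_take_drop_id mset_append)
  ultimately have "size (filter_mset (\<lambda>x. c < x) (mset ?xs)) \<ge> CARD('n) - (i - 1)"
    using len by simp
  moreover have "mset ?xs = image_mset d (mset_set UNIV)"
    using pr by (simp add: sorted_eigvals_def)
  ultimately have "card {j. c < d j} \<ge> 2"
    using i by (simp add: filter_mset_image_mset)
  then obtain j k where jk: "j \<noteq> k" "c < d j" "c < d k"
    by (auto simp: card_le_Suc_iff numeral_2_eq_2)
  show False
  proof (cases "b k \<bullet> a = 0")
    case True
    then show False using le[of "b k"] jk by (simp add: b d)
  next
    case False
    \<comment> \<open>The combination of the two eigenvectors that is orthogonal to \<open>a\<close>.\<close>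
    let ?x = "(b k \<bullet> a) *\<^sub>R b j - (b j \<bullet> a) *\<^sub>R b k"
    have "?x \<bullet> a = 0" by (simp add: inner_diff_left)
    moreover have "?x \<bullet> (A *v ?x) = d j * (b k \<bullet> a)\<^sup>2 + d k * (b j \<bullet> a)\<^sup>2"
      using jk(1) by (simp add: matrix_vector_mult_diff_distrib matrix_vector_mult_scaleR d b
          inner_diff_left inner_diff_right power2_eq_square)
    moreover have "?x \<bullet> ?x = (b k \<bullet> a)\<^sup>2 + (b j \<bullet> a)\<^sup>2"
      using jk(1) by (simp add: b inner_diff_left inner_diff_right power2_eq_square)
    ultimately have "d j * (b k \<bullet> a)\<^sup>2 + d k * (b j \<bullet> a)\<^sup>2 \<le> c * ((b k \<bullet> a)\<^sup>2 + (b j \<bullet> a)\<^sup>2)"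
      using le[of ?x] by simp
    moreover have "c * (b k \<bullet> a)\<^sup>2 < d j * (b k \<bullet> a)\<^sup>2"
      using False jk by simp
    moreover have "c * (b j \<bullet> a)\<^sup>2 \<le> d k * (b j \<bullet> a)\<^sup>2"
      using jk by (intro mult_right_mono) auto
    ultimately show False by (simp add: algebra_simps)
  qed
qed

section \<open>Second-order calculus\<close>

lemma gderiv_unique:
  assumes "GDERIV f x :> D" "GDERIV f x :> E" shows "D = E"
proof -
  have "(\<lambda>h. h \<bullet> D) = (\<lambda>h. h \<bullet> E)"
    using assms unfolding gderiv_def by (rule has_derivative_unique)
  then have "h \<bullet> (D - E) = 0" for h
    by (simp add: inner_diff_right fun_eq_iff)
  from this[of "D - E"] show ?thesis by simp
qed

lemma gradient_eqI: "GDERIV f x :> D \<Longrightarrow> gradient f x = D"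
  unfolding gradient_def by (rule the_equality) (auto intro: gderiv_unique)

lemma gderiv_gradient:
  fixes f :: "real^'n \<Rightarrow> real"
  assumes "f differentiable at x"
  shows "GDERIV f x :> gradient f x"
proof -
  obtain f' where f': "(f has_derivative f') (at x)"
    using assms by (auto simp: differentiable_def)
  then have "linear f'" by (rule has_derivative_linear)
  then have "f' = (\<lambda>h. h \<bullet> adjoint f' 1)"
    using adjoint_works[of f' _ 1] by auto
  then have "GDERIV f x :> adjoint f' 1"
    using f' by (simp add: gderiv_def)
  then show ?thesis using gradient_eqI by metis
qed

lemma hessian_eqI:
  assumes "(gradient f has_derivative (\<lambda>h. A *v h)) (at x)"
  shows "hessian f x = A"
  unfolding hessian_def jacobian_def
  using frechet_derivative_at[OF assms] by (metis matrix_of_matrix_vector_mul)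

lemma add_mem_ball_iff:
  fixes x w :: "'a::real_normed_vector"
  shows "x + w \<in> ball x d \<longleftrightarrow> norm w < d"
  by (metis add_diff_cancel_left' dist_commute dist_norm mem_ball)

text \<open>
The mean value theorem for \<open>s \<mapsto> f (x + s u + t v) - f (x + s u)\<close> reduces the second difference to
increments of the gradient, where the first-order expansion at the single point \<open>x\<close> applies.
\<close>

lemma second_difference_bound:
  fixes f :: "'a::real_inner \<Rightarrow> real"
  assumes S: "open S" "x \<in> S"
    and f: "\<And>y. y \<in> S \<Longrightarrow> GDERIV f y :> g y"
    and g: "(g has_derivative H) (at x)"
    and "0 < e"
  shows "\<forall>\<^sub>F t in at_right 0.
    \<bar>f (x + t *\<^sub>R u + t *\<^sub>R v) - f (x + t *\<^sub>R u) - f (x + t *\<^sub>R v) + f x - t\<^sup>2 * (u \<bullet> H v)\<bar> \<le> e * t\<^sup>2"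
proof -
  define M where "M = 2 * norm u * (norm u + norm v) + 1"
  have M: "M > 0" by (simp add: M_def add_nonneg_pos)
  have linH: "linear H" using g by (rule has_derivative_linear)
  define r where "r = (\<lambda>y. g y - g x - H (y - x))"
  obtain d1 where d1: "d1 > 0" "\<And>y. norm (y - x) < d1 \<Longrightarrow> norm (r y) \<le> e / M * norm (y - x)"
    using g M \<open>0 < e\<close> unfolding has_derivative_at_alt r_def by (meson divide_pos_pos)
  obtain d2 where d2: "d2 > 0" "ball x d2 \<subseteq> S"
    using S open_contains_ball by blast
  define d where "d = min d1 d2 / (norm u + norm v + 1)"
  have d: "d > 0" using d1 d2 by (simp add: d_def add_nonneg_pos)
  have small: "norm (s *\<^sub>R u + s' *\<^sub>R v) < min d1 d2"
    "norm (s *\<^sub>R u + s' *\<^sub>R v) \<le> t * (norm u + norm v)"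
    if "0 \<le> s" "s \<le> t" "0 \<le> s'" "s' \<le> t" "0 < t" "t < d" for s s' t
  proof -
    have "norm (s *\<^sub>R u + s' *\<^sub>R v) \<le> s * norm u + s' * norm v"
      using that norm_triangle_ineq[of "s *\<^sub>R u" "s' *\<^sub>R v"] by simp
    also have "\<dots> \<le> t * norm u + t * norm v"
      using that by (intro add_mono mult_right_mono) auto
    finally show *: "norm (s *\<^sub>R u + s' *\<^sub>R v) \<le> t * (norm u + norm v)"
      by (simp add: algebra_simps)
    have "t * (norm u + norm v) < d * (norm u + norm v + 1)"
      using that d by (intro mult_strict_mono') (auto simp: add_nonneg_pos)
    also have "\<dots> = min d1 d2"
    proof -
      have "norm u + norm v + 1 > 0" by (simp add: add_nonneg_pos)
      then show ?thesis by (simp add: d_def)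
    qed
    finally show "norm (s *\<^sub>R u + s' *\<^sub>R v) < min d1 d2" using * by simp
  qed
  have "\<bar>f (x + t *\<^sub>R u + t *\<^sub>R v) - f (x + t *\<^sub>R u) - f (x + t *\<^sub>R v) + f x - t\<^sup>2 * (u \<bullet> H v)\<bar> \<le> e * t\<^sup>2"
    if t: "0 < t" "t < d" for t
  proof -
    define k where "k = (\<lambda>s. f (x + (s *\<^sub>R u + t *\<^sub>R v)) - f (x + (s *\<^sub>R u + 0 *\<^sub>R v)))"
    define k' where "k' = (\<lambda>s. u \<bullet> g (x + (s *\<^sub>R u + t *\<^sub>R v)) - u \<bullet> g (x + (s *\<^sub>R u + 0 *\<^sub>R v)))"
    have k: "(k has_real_derivative k' s) (at s)" if s: "0 \<le> s" "s \<le> t" for s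
    proof -
      have *: "((\<lambda>s. f (x + (s *\<^sub>R u + s' *\<^sub>R v))) has_real_derivative u \<bullet> g (x + (s *\<^sub>R u + s' *\<^sub>R v))) (at s)"
        if "s' = 0 \<or> s' = t" for s'
      proof -
        have "norm (s *\<^sub>R u + s' *\<^sub>R v) < min d1 d2"
          using small(1)[of s t s'] s t that by auto
        then have "x + (s *\<^sub>R u + s' *\<^sub>R v) \<in> ball x d2"
          unfolding add_mem_ball_iff by simp
        then have "x + (s *\<^sub>R u + s' *\<^sub>R v) \<in> S" using d2(2) by blast
        then have "(f has_derivative (\<lambda>h. h \<bullet> g (x + (s *\<^sub>R u + s' *\<^sub>R v)))) (at (x + (s *\<^sub>R u + s' *\<^sub>R v)))"
          using f by (simp add: gderiv_def)
        moreover have "((\<lambda>s. x + (s *\<^sub>R u + s' *\<^sub>R v)) has_derivative (\<lambda>h. h *\<^sub>R u)) (at s)"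
          by (auto intro!: derivative_eq_intros)
        ultimately have "((\<lambda>s. f (x + (s *\<^sub>R u + s' *\<^sub>R v))) has_derivative
            (\<lambda>h. (h *\<^sub>R u) \<bullet> g (x + (s *\<^sub>R u + s' *\<^sub>R v)))) (at s)"
          by (rule has_derivative_compose[rotated])
        then show ?thesis
          by (rule has_derivative_imp_has_field_derivative) simp
      qed
      show ?thesis unfolding k_def k'_def by (intro DERIV_diff *) auto
    qed
    obtain \<xi> where \<xi>: "0 < \<xi>" "\<xi> < t" "k t - k 0 = (t - 0) * k' \<xi>"
      using MVT2[of 0 t k k'] t k by auto
    let ?a = "\<xi> *\<^sub>R u + t *\<^sub>R v" and ?b = "\<xi> *\<^sub>R u + 0 *\<^sub>R v"
    have "k' \<xi> - t * (u \<bullet> H v) = u \<bullet> (r (x + ?a) - r (x + ?b))"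
      by (simp add: k'_def r_def linear_add[OF linH] linear_scale[OF linH] inner_diff_right inner_add_right)
    then have "\<bar>k' \<xi> - t * (u \<bullet> H v)\<bar> \<le> norm u * norm (r (x + ?a) - r (x + ?b))"
      using Cauchy_Schwarz_ineq2 by metis
    also have "\<dots> \<le> norm u * (norm (r (x + ?a)) + norm (r (x + ?b)))"
      by (intro mult_left_mono norm_triangle_ineq4) auto
    also have "\<dots> \<le> norm u * (e / M * (t * (norm u + norm v)) + e / M * (t * (norm u + norm v)))"
    proof (intro mult_left_mono add_mono norm_ge_zero)
      have eM: "0 \<le> e / M" using M \<open>0 < e\<close> by simp
      have "norm (r (x + ?a)) \<le> e / M * norm ?a"
        using d1(2)[of "x + ?a"] small(1)[of \<xi> t t] \<xi> t by simp
      also have "\<dots> \<le> e / M * (t * (norm u + norm v))"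
        using small(2)[of \<xi> t t] \<xi> t eM by (intro mult_left_mono) auto
      finally show "norm (r (x + ?a)) \<le> e / M * (t * (norm u + norm v))" .
      have "norm (r (x + ?b)) \<le> e / M * norm ?b"
        using d1(2)[of "x + ?b"] small(1)[of \<xi> t 0] \<xi> t by simp
      also have "\<dots> \<le> e / M * (t * (norm u + norm v))"
        using small(2)[of \<xi> t 0] \<xi> t eM by (intro mult_left_mono) auto
      finally show "norm (r (x + ?b)) \<le> e / M * (t * (norm u + norm v))" .
    qed
    also have "\<dots> = e / M * (M - 1) * t"
      by (simp add: M_def algebra_simps)
    also have "\<dots> \<le> e * t"
      using M t \<open>0 < e\<close> by (intro mult_right_mono) (auto simp: divide_simps)
    finally have "\<bar>k' \<xi> - t * (u \<bullet> H v)\<bar> * t \<le> e * t * t"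
      using t by (intro mult_right_mono) auto
    moreover have "\<bar>k' \<xi> - t * (u \<bullet> H v)\<bar> * t = \<bar>k t - k 0 - t\<^sup>2 * (u \<bullet> H v)\<bar>"
    proof -
      have "k t - k 0 - t\<^sup>2 * (u \<bullet> H v) = (k' \<xi> - t * (u \<bullet> H v)) * t"
        using \<xi>(3) by (simp add: algebra_simps power2_eq_square)
      then show ?thesis using t by (simp add: abs_mult)
    qed
    ultimately show ?thesis
      by (simp add: k_def algebra_simps power2_eq_square)
  qed
  then show ?thesis
    unfolding eventually_at_right_field using d by blast
qed

text \<open>
The second difference is symmetric in \<open>u\<close> and \<open>v\<close>, hence so is its limit.
\<close>

lemma second_derivative_symmetric:
  fixes f :: "'a::real_inner \<Rightarrow> real"
  assumes "open S" "x \<in> S" "\<And>y. y \<in> S \<Longrightarrow> GDERIV f y :> g y" "(g has_derivative H) (at x)"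
  shows "u \<bullet> H v = v \<bullet> H u"
proof -
  have "\<bar>u \<bullet> H v - v \<bullet> H u\<bar> \<le> e" if "0 < e" for e
  proof -
    have "e / 2 > 0" using that by simp
    have *: "\<forall>\<^sub>F t in at_right 0.
        \<bar>f (x + t *\<^sub>R u + t *\<^sub>R v) - f (x + t *\<^sub>R u) - f (x + t *\<^sub>R v) + f x - t\<^sup>2 * (u \<bullet> H v)\<bar>
          \<le> e / 2 * t\<^sup>2" for u v
      using second_difference_bound[OF assms(1,2) _ assms(4) \<open>e / 2 > 0\<close>] assms(3) by blast
    have "\<forall>\<^sub>F t in at_right (0::real). \<bar>u \<bullet> H v - v \<bullet> H u\<bar> \<le> e"
      using *[of u v] *[of v u] eventually_at_right_less[of 0]
    proof eventually_elim
      case (elim t)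
      have "\<bar>t\<^sup>2 * (u \<bullet> H v) - t\<^sup>2 * (v \<bullet> H u)\<bar> \<le> e * t\<^sup>2"
      proof -
        have "f (x + t *\<^sub>R v + t *\<^sub>R u) = f (x + t *\<^sub>R u + t *\<^sub>R v)"
          by (simp add: add.commute add.left_commute)
        then show ?thesis using elim(1,2) by linarith
      qed
      then have "\<bar>u \<bullet> H v - v \<bullet> H u\<bar> * t\<^sup>2 \<le> e * t\<^sup>2"
        by (simp add: abs_mult flip: right_diff_distrib) (simp add: mult.commute)
      then show ?case using elim(3) by simp
    qed
    then show ?thesis by (simp add: trivial_limit_at_right_real)
  qed
  then have "\<bar>u \<bullet> H v - v \<bullet> H u\<bar> \<le> 0" by (rule field_le_epsilon[where y=0, simplified])
  then show ?thesis by simp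
qed

text \<open>
A one-sided second-order expansion that asks for the second derivative at \<open>0\<close> only: after
subtracting the parabola the derivative is positive immediately to the right of \<open>0\<close>.
\<close>

lemma quadratic_lower_bound_real:
  fixes f f' :: "real \<Rightarrow> real"
  assumes "0 < a" and f: "\<And>t. 0 \<le> t \<Longrightarrow> t < a \<Longrightarrow> (f has_real_derivative f' t) (at t)"
    and f': "(f' has_real_derivative d) (at 0)" and "c < d"
  shows "\<forall>\<^sub>F t in at_right 0. f 0 + f' 0 * t + c / 2 * t\<^sup>2 < f t"
proof -
  have "((\<lambda>t. (f' t - f' 0) / t) \<longlongrightarrow> d) (at_right 0)"
    using f' unfolding has_field_derivative_iff
    by (auto intro: tendsto_mono[OF at_le])
  then have "\<forall>\<^sub>F t in at_right 0. c < (f' t - f' 0) / t"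
    using \<open>c < d\<close> by (rule order_tendstoD)
  then obtain b where b: "b > 0" "\<And>t. 0 < t \<Longrightarrow> t < b \<Longrightarrow> c < (f' t - f' 0) / t"
    unfolding eventually_at_right_field by auto
  have "f 0 + f' 0 * t + c / 2 * t\<^sup>2 < f t" if t: "0 < t" "t < min a b" for t
  proof -
    define m where "m = (\<lambda>t. f t - f' 0 * t - c / 2 * t\<^sup>2)"
    have "(m has_real_derivative f' s - f' 0 - c * s) (at s)" if "0 \<le> s" "s \<le> t" for s
      unfolding m_def using t that by (auto intro!: derivative_eq_intros f)
    then obtain s where s: "0 < s" "s < t" "m t - m 0 = (t - 0) * (f' s - f' 0 - c * s)"
      using MVT2[of 0 t m "\<lambda>s. f' s - f' 0 - c * s"] t by auto
    have "f' s - f' 0 - c * s > 0"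
      using b(2)[of s] s t by (simp add: field_simps)
    then have "m t - m 0 > 0" using s t by simp
    then show ?thesis by (simp add: m_def)
  qed
  then show ?thesis
    unfolding eventually_at_right_field using \<open>0 < a\<close> b(1) by (intro exI[of _ "min a b"]) auto
qed

lemma quadratic_lower_bound:
  fixes f :: "'a::real_inner \<Rightarrow> real"
  assumes S: "open S" "x \<in> S" and f: "\<And>y. y \<in> S \<Longrightarrow> GDERIV f y :> g y"
    and g: "(g has_derivative H) (at x)" and "c < e \<bullet> H e"
  shows "\<forall>\<^sub>F t in at_right 0. f x + t * (e \<bullet> g x) + c / 2 * t\<^sup>2 < f (x + t *\<^sub>R e)"
proof -
  obtain d where d: "d > 0" "ball x d \<subseteq> S"
    using S open_contains_ball by blast
  define a where "a = d / (norm e + 1)"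
  have a: "a > 0" using d by (simp add: a_def add_nonneg_pos)
  have der: "((\<lambda>t. f (x + t *\<^sub>R e)) has_real_derivative e \<bullet> g (x + t *\<^sub>R e)) (at t)"
    if "0 \<le> t" "t < a" for t
  proof -
    have "t * (norm e + 1) < d"
      using that(2) by (simp add: a_def pos_less_divide_eq add_nonneg_pos)
    then have "norm (t *\<^sub>R e) < d" using that(1) by (simp add: algebra_simps)
    then have "x + t *\<^sub>R e \<in> S" using d(2) by (auto simp: subset_iff dist_norm)
    then have "(f has_derivative (\<lambda>h. h \<bullet> g (x + t *\<^sub>R e))) (at (x + t *\<^sub>R e))"
      using f by (simp add: gderiv_def)
    moreover have "((\<lambda>t. x + t *\<^sub>R e) has_derivative (\<lambda>h. h *\<^sub>R e)) (at t)"
      by (auto intro!: derivative_eq_intros)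
    ultimately have "((\<lambda>t. f (x + t *\<^sub>R e)) has_derivative (\<lambda>h. (h *\<^sub>R e) \<bullet> g (x + t *\<^sub>R e))) (at t)"
      by (rule has_derivative_compose[rotated])
    then show ?thesis by (rule has_derivative_imp_has_field_derivative) simp
  qed
  have "((\<lambda>t. x + t *\<^sub>R e) has_derivative (\<lambda>h. h *\<^sub>R e)) (at 0)"
    by (auto intro!: derivative_eq_intros)
  then have "((\<lambda>t. g (x + t *\<^sub>R e)) has_derivative (\<lambda>h. H (h *\<^sub>R e))) (at 0)"
    using g by (intro has_derivative_compose[where f="\<lambda>t. x + t *\<^sub>R e" and g=g]) auto
  then have "((\<lambda>t. e \<bullet> g (x + t *\<^sub>R e)) has_derivative (\<lambda>h. e \<bullet> H (h *\<^sub>R e))) (at 0)"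
    by (rule has_derivative_inner_right)
  then have "((\<lambda>t. e \<bullet> g (x + t *\<^sub>R e)) has_real_derivative e \<bullet> H e) (at 0)"
    by (rule has_derivative_imp_has_field_derivative)
      (use g in \<open>simp add: linear_scale[OF has_derivative_linear]\<close>)
  from quadratic_lower_bound_real[OF a der this \<open>c < e \<bullet> H e\<close>] show ?thesis
    by (simp add: mult.commute)
qed

lemma C2_onD:
  fixes f :: "real^'n \<Rightarrow> real"
  assumes "C2_on S f" "x \<in> S"
  shows "GDERIV f x :> gradient f x"
    and "(gradient f has_derivative (\<lambda>h. hessian f x *v h)) (at x)"
  using assms by (auto simp: C2_on_def gderiv_gradient hessian_def jacobian_works[symmetric])

lemma transpose_hessian:
  fixes f :: "real^'n \<Rightarrow> real"
  assumes "C2_on S f" "open S" "x \<in> S"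
  shows "transpose (hessian f x) = hessian f x"
proof -
  let ?A = "hessian f x"
  have sym: "u \<bullet> (?A *v v) = v \<bullet> (?A *v u)" for u v
    using assms by (intro second_derivative_symmetric[of S]) (auto intro: C2_onD)
  have comp: "?A $ k $ l = axis k 1 \<bullet> (?A *v axis l 1)" for k l
    by (simp add: inner_axis' matrix_vector_mult_basis column_def)
  have "?A $ k $ l = ?A $ l $ k" for k l
    unfolding comp by (rule sym)
  then show ?thesis by (simp add: transpose_def vec_eq_iff)
qed

lemma gderiv_inner_self: "GDERIV (\<lambda>y. y \<bullet> y) x :> 2 *\<^sub>R x"
proof -
  have "((\<lambda>y. y \<bullet> y) has_derivative (\<lambda>h. x \<bullet> h + h \<bullet> x)) (at x)"
    by (rule has_derivative_inner[OF has_derivative_ident has_derivative_ident])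
  moreover have "x \<bullet> h + h \<bullet> x = h \<bullet> (2 *\<^sub>R x)" for h
    by (simp add: inner_commute)
  ultimately show ?thesis by (simp only: gderiv_def)
qed

text \<open>
Radial polynomials \<open>a |y|\<^sup>4 + b |y|\<^sup>2 + c\<close> are the only test functions applied to unknown
solutions: paraboloids (\<open>a = 0\<close>) from below and \<open>K (|y|\<^sup>2 - \<beta>)\<^sup>2\<close> from above.
\<close>

lemma gderiv_radial_quartic:
  fixes x :: "real^'n"
  shows "GDERIV (\<lambda>y. a * (y \<bullet> y)\<^sup>2 + b * (y \<bullet> y) + c) x :> (4 * a * (x \<bullet> x) + 2 * b) *\<^sub>R x"
proof -
  have 1: "DERIV (\<lambda>s. a * s\<^sup>2 + b * s + c) (x \<bullet> x) :> 2 * a * (x \<bullet> x) + b"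
    by (auto intro!: derivative_eq_intros)
  have 2: "(2 * a * (x \<bullet> x) + b) *\<^sub>R 2 *\<^sub>R x = (4 * a * (x \<bullet> x) + 2 * b) *\<^sub>R x"
    by (simp add: algebra_simps)
  show ?thesis using GDERIV_DERIV_compose[OF gderiv_inner_self 1] unfolding 2 .
qed

lemma gradient_radial_quartic:
  fixes x :: "real^'n"
  shows "gradient (\<lambda>y. a * (y \<bullet> y)\<^sup>2 + b * (y \<bullet> y) + c) x = (4 * a * (x \<bullet> x) + 2 * b) *\<^sub>R x"
  by (rule gradient_eqI[OF gderiv_radial_quartic])

lemma hessian_radial_quartic_deriv:
  fixes x h :: "real^'n" and a b c :: real
  defines "M \<equiv> \<lambda>x::real^'n. \<chi> k l. (if k = l then 4 * a * (x \<bullet> x) + 2 * b else 0) + 8 * a * x $ k * x $ l"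
  shows "(gradient (\<lambda>y. a * (y \<bullet> y)\<^sup>2 + b * (y \<bullet> y) + c) has_derivative (\<lambda>h. M x *v h)) (at x)"
    and "M x *v h = (4 * a * (x \<bullet> x) + 2 * b) *\<^sub>R h + (8 * a * (x \<bullet> h)) *\<^sub>R x"
proof -
  have M: "M x *v h = (4 * a * (x \<bullet> x) + 2 * b) *\<^sub>R h + (8 * a * (x \<bullet> h)) *\<^sub>R x" for h
  proof -
    have "(M x *v h) $ k = ((4 * a * (x \<bullet> x) + 2 * b) *\<^sub>R h + (8 * a * (x \<bullet> h)) *\<^sub>R x) $ k" for k
    proof -
      have "(M x *v h) $ k = (\<Sum>l\<in>UNIV. (if k = l then 4 * a * (x \<bullet> x) + 2 * b else 0) * h $ l)
          + (\<Sum>l\<in>UNIV. 8 * a * x $ k * x $ l * h $ l)"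
        by (simp add: M_def matrix_vector_mult_def distrib_right sum.distrib)
      also have "(\<Sum>l\<in>UNIV. (if k = l then 4 * a * (x \<bullet> x) + 2 * b else 0) * h $ l)
          = (4 * a * (x \<bullet> x) + 2 * b) * h $ k"
        by (simp add: if_distrib[of "\<lambda>z. z * _"] cong: if_cong)
      also have "(\<Sum>l\<in>UNIV. 8 * a * x $ k * x $ l * h $ l) = 8 * a * (x \<bullet> h) * x $ k"
        unfolding inner_vec_def by (simp add: sum_distrib_left sum_distrib_right algebra_simps)
      finally show ?thesis by simp
    qed
    then show ?thesis by (simp add: vec_eq_iff)
  qed
  then show "M x *v h = (4 * a * (x \<bullet> x) + 2 * b) *\<^sub>R h + (8 * a * (x \<bullet> h)) *\<^sub>R x" .
  have grad: "gradient (\<lambda>y. a * (y \<bullet> y)\<^sup>2 + b * (y \<bullet> y) + c) = (\<lambda>x. (4 * a * (x \<bullet> x) + 2 * b) *\<^sub>R x)"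
    by (rule ext) (rule gradient_radial_quartic)
  have "((\<lambda>x. x \<bullet> x) has_derivative (\<lambda>h. h \<bullet> (2 *\<^sub>R x))) (at x)"
    using gderiv_inner_self unfolding gderiv_def .
  then have "((\<lambda>x. 4 * a * (x \<bullet> x) + 2 * b) has_derivative (\<lambda>h. 4 * a * (h \<bullet> (2 *\<^sub>R x)))) (at x)"
    by (intro has_derivative_add_const has_derivative_mult_right)
  from has_derivative_scaleR[OF this has_derivative_ident]
  show "(gradient (\<lambda>y. a * (y \<bullet> y)\<^sup>2 + b * (y \<bullet> y) + c) has_derivative (\<lambda>h. M x *v h)) (at x)"
    unfolding M grad by (simp add: inner_commute mult.assoc)
qed

lemma hessian_radial_quartic:
  fixes x :: "real^'n"
  shows "hessian (\<lambda>y. a * (y \<bullet> y)\<^sup>2 + b * (y \<bullet> y) + c) x *v h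
     = (4 * a * (x \<bullet> x) + 2 * b) *\<^sub>R h + (8 * a * (x \<bullet> h)) *\<^sub>R x"
  unfolding hessian_eqI[OF hessian_radial_quartic_deriv(1)] by (rule hessian_radial_quartic_deriv(2))

lemma C2_on_radial_quartic: "C2_on S (\<lambda>y::real^'n. a * (y \<bullet> y)\<^sup>2 + b * (y \<bullet> y) + c)"
  unfolding C2_on_def hessian_eqI[OF hessian_radial_quartic_deriv(1)]
proof (intro conjI ballI)
  fix x :: "real^'n"
  show "(\<lambda>y::real^'n. a * (y \<bullet> y)\<^sup>2 + b * (y \<bullet> y) + c) differentiable at x"
    using gderiv_radial_quartic unfolding gderiv_def differentiable_def by blast
  show "gradient (\<lambda>y::real^'n. a * (y \<bullet> y)\<^sup>2 + b * (y \<bullet> y) + c) differentiable at x"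
    using hessian_radial_quartic_deriv(1) unfolding differentiable_def by blast
next
  show "continuous_on S (\<lambda>x::real^'n. \<chi> k l. (if k = l then 4 * a * (x \<bullet> x) + 2 * b else 0) + 8 * a * x $ k * x $ l)"
  proof (intro continuous_on_vec_lambda)
    fix k l :: 'n
    show "continuous_on S (\<lambda>x::real^'n. (if k = l then 4 * a * (x \<bullet> x) + 2 * b else 0) + 8 * a * x $ k * x $ l)"
      by (cases "k = l") (auto intro!: continuous_intros)
  qed
qed

lemma gradient_eq_of_touching:
  fixes f u :: "real^'n \<Rightarrow> real"
  assumes f: "GDERIV f x :> gradient f x" and u: "GDERIV u x :> D"
    and touch: "(\<forall>\<^sub>F y in at x. f y - f x \<le> u y - u x) \<or> (\<forall>\<^sub>F y in at x. u y - u x \<le> f y - f x)"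
  shows "gradient f x = D"
proof -
  have der: "((\<lambda>y. f y - u y) has_derivative (\<lambda>h. h \<bullet> gradient f x - h \<bullet> D)) (at x)"
    using f u unfolding gderiv_def by (rule has_derivative_diff)
  have "\<exists>S. open S \<and> x \<in> S \<and> ((\<forall>y\<in>S. f y - u y \<le> f x - u x) \<or> (\<forall>y\<in>S. f x - u x \<le> f y - u y))"
    using touch
  proof
    assume "\<forall>\<^sub>F y in at x. f y - f x \<le> u y - u x"
    then obtain S where S: "open S" "x \<in> S" "\<forall>y\<in>S. y \<noteq> x \<longrightarrow> f y - f x \<le> u y - u x"
      unfolding eventually_at_topological by blast
    have "f y - u y \<le> f x - u x" if "y \<in> S" for y
      using S(3) that by (cases "y = x") (auto simp: algebra_simps)
    then show ?thesis using S by blast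
  next
    assume "\<forall>\<^sub>F y in at x. u y - u x \<le> f y - f x"
    then obtain S where S: "open S" "x \<in> S" "\<forall>y\<in>S. y \<noteq> x \<longrightarrow> u y - u x \<le> f y - f x"
      unfolding eventually_at_topological by blast
    have "f x - u x \<le> f y - u y" if "y \<in> S" for y
      using S(3) that by (cases "y = x") (auto simp: algebra_simps)
    then show ?thesis using S by blast
  qed
  then obtain S where "open S" "x \<in> S"
    "(\<forall>y\<in>S. f y - u y \<le> f x - u x) \<or> (\<forall>y\<in>S. f x - u x \<le> f y - u y)" by blast
  then have "(\<lambda>h. h \<bullet> gradient f x - h \<bullet> D) = (\<lambda>h. 0)"
    using der by (intro differential_zero_maxmin[of x S]) auto
  then have "(gradient f x - D) \<bullet> (gradient f x - D) = 0"
    by (metis inner_diff_right)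
  then show ?thesis by simp
qed

lemma eventually_along_line:
  fixes x e :: "'a::real_normed_vector"
  assumes "\<forall>\<^sub>F y in at x. P y" "e \<noteq> 0"
  shows "\<forall>\<^sub>F t in at_right 0. P (x + t *\<^sub>R e)"
proof -
  have "filterlim (\<lambda>t. x + t *\<^sub>R e) (at x) (at_right 0)"
    unfolding filterlim_at
  proof
    show "\<forall>\<^sub>F t in at_right 0. x + t *\<^sub>R e \<in> UNIV \<and> x + t *\<^sub>R e \<noteq> x"
      using eventually_at_right_less[of 0] by eventually_elim (use assms(2) in auto)
    show "((\<lambda>t. x + t *\<^sub>R e) \<longlongrightarrow> x) (at_right 0)"
      by (auto intro!: tendsto_eq_intros)
  qed
  then show ?thesis using assms(1) by (rule eventually_compose_filterlim[rotated])
qed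

text \<open>
Here \<open>f\<close> minus the paraboloid has a local minimum at \<open>x\<close>, which bounds the Hessian from below
in every direction.
\<close>

lemma eigval_hessian_ge_of_paraboloid_below:
  fixes f :: "real^'n \<Rightarrow> real"
  assumes C2: "C2_on S f" "open S" "x \<in> S" and i: "1 \<le> i" "i \<le> CARD('n)"
    and touch: "\<forall>\<^sub>F y in at x. q / 2 * (y \<bullet> y - x \<bullet> x) \<le> f y - f x"
  shows "gradient f x = q *\<^sub>R x" and "q \<le> eigval i (hessian f x)"
proof -
  have "GDERIV (\<lambda>y. q / 2 * (y \<bullet> y)) x :> q *\<^sub>R x"
    using gderiv_radial_quartic[of 0 "q/2" 0 x] by simp
  with touch show grad: "gradient f x = q *\<^sub>R x"
    by (intro gradient_eq_of_touching[OF C2_onD(1)[OF C2(1,3)]]) (auto simp: right_diff_distrib)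
  show "q \<le> eigval i (hessian f x)"
  proof (rule eigval_ge[OF transpose_hessian[OF C2] i])
    fix e :: "real^'n"
    show "q * (e \<bullet> e) \<le> e \<bullet> (hessian f x *v e)"
    proof (rule ccontr)
      assume "\<not> ?thesis"
      then have less: "- (q * (e \<bullet> e)) < e \<bullet> - (hessian f x *v e)" by simp
      then have "e \<noteq> 0" by auto
      have "\<forall>\<^sub>F t in at_right 0. - f x + t * (e \<bullet> - gradient f x) + - (q * (e \<bullet> e)) / 2 * t\<^sup>2 < - f (x + t *\<^sub>R e)"
      proof (rule quadratic_lower_bound[OF C2(2,3), where f="\<lambda>y. - f y" and g="\<lambda>y. - gradient f y"
            and H="\<lambda>h. - (hessian f x *v h)" and c="- (q * (e \<bullet> e))"])
        show "- (q * (e \<bullet> e)) < e \<bullet> - (hessian f x *v e)" by (rule less)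
        show "GDERIV (\<lambda>y. - f y) y :> - gradient f y" if "y \<in> S" for y
          using C2_onD(1)[OF C2(1) that] unfolding gderiv_def by (auto dest: has_derivative_minus)
        show "((\<lambda>y. - gradient f y) has_derivative (\<lambda>h. - (hessian f x *v h))) (at x)"
          by (rule has_derivative_minus[OF C2_onD(2)[OF C2(1,3)]])
      qed
      moreover have "\<forall>\<^sub>F t in at_right 0. q / 2 * ((x + t *\<^sub>R e) \<bullet> (x + t *\<^sub>R e) - x \<bullet> x) \<le> f (x + t *\<^sub>R e) - f x"
        by (rule eventually_along_line[OF touch \<open>e \<noteq> 0\<close>])
      ultimately have "\<forall>\<^sub>F t in at_right (0::real). False"
      proof eventually_elim
        case (elim t)
        then show ?case unfolding grad
          by (simp add: inner_add_left inner_add_right inner_commute algebra_simps power2_eq_square)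
      qed
      then show False by (simp add: trivial_limit_at_right_real)
    qed
  qed
qed

text \<open>
Along \<open>x + t e\<close> with \<open>e\<close> orthogonal to \<open>x\<close> the quantity \<open>|x|\<^sup>2\<close> changes only by \<open>t\<^sup>2 |e|\<^sup>2\<close>, so the
first derivative of \<open>H\<close> already controls the second derivative of \<open>f\<close> in the \<open>N - 1\<close> tangential
directions; for \<open>i < N\<close> these determine an upper bound of \<open>\<lambda>\<^sub>i\<close>.
\<close>

lemma eigval_hessian_le_of_radial_above:
  fixes f :: "real^'n \<Rightarrow> real"
  assumes C2: "C2_on (ball 0 R) f" "x \<in> ball 0 R" and i: "1 \<le> i" "i < CARD('n)"
    and H: "(H has_real_derivative q / 2) (at (x \<bullet> x) within {0..R\<^sup>2})"
    and touch: "\<forall>\<^sub>F y in at x. f y - f x \<le> H (y \<bullet> y) - H (x \<bullet> x)"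
  shows "gradient f x = q *\<^sub>R x" and "eigval i (hessian f x) \<le> q"
proof -
  have in_range: "y \<bullet> y \<in> {0..R\<^sup>2}" if "y \<in> ball 0 R" for y :: "real^'n"
    using that power_mono[of "norm y" R 2] by (simp flip: power2_norm_eq_inner)
  have sq: "((\<lambda>y. y \<bullet> y) has_derivative (\<lambda>h. x \<bullet> h + h \<bullet> x)) (at x within ball 0 R)"
    by (rule has_derivative_inner[OF has_derivative_ident has_derivative_ident])
  have "(H has_derivative (\<lambda>h. q / 2 * h)) (at (x \<bullet> x) within {0..R\<^sup>2})"
    using H unfolding has_field_derivative_def .
  then have "(H has_derivative (\<lambda>h. q / 2 * h)) (at (x \<bullet> x) within (\<lambda>y::real^'n. y \<bullet> y) ` ball 0 R)"
    by (rule has_derivative_subset) (use in_range in auto)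
  from has_derivative_in_compose[OF sq this]
  have "((\<lambda>y. H (y \<bullet> y)) has_derivative (\<lambda>h. q / 2 * (x \<bullet> h + h \<bullet> x))) (at x within ball 0 R)" .
  moreover have "q / 2 * (x \<bullet> h + h \<bullet> x) = h \<bullet> (q *\<^sub>R x)" for h
    by (simp add: inner_commute)
  ultimately have "GDERIV (\<lambda>y. H (y \<bullet> y)) x :> q *\<^sub>R x"
    by (simp only: gderiv_def at_within_open[OF C2(2) open_ball])
  with touch show grad: "gradient f x = q *\<^sub>R x"
    by (intro gradient_eq_of_touching[OF C2_onD(1)[OF C2]]) auto
  show "eigval i (hessian f x) \<le> q"
  proof (rule eigval_le[OF transpose_hessian[OF C2(1) open_ball C2(2)] i])
    fix e :: "real^'n" assume "e \<bullet> x = 0"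
    show "e \<bullet> (hessian f x *v e) \<le> q * (e \<bullet> e)"
    proof (rule ccontr)
      assume "\<not> ?thesis"
      then have less: "q * (e \<bullet> e) < e \<bullet> (hessian f x *v e)" by simp
      then have "e \<noteq> 0" by auto
      obtain c where c: "q * (e \<bullet> e) < c" "c < e \<bullet> (hessian f x *v e)"
        using less dense by blast
      have 1: "\<forall>\<^sub>F t in at_right 0. f x + t * (e \<bullet> gradient f x) + c / 2 * t\<^sup>2 < f (x + t *\<^sub>R e)"
        by (rule quadratic_lower_bound[OF open_ball C2(2) _ C2_onD(2)[OF C2] c(2)])
           (rule C2_onD(1)[OF C2(1)])
      have 2: "\<forall>\<^sub>F t in at_right 0. f (x + t *\<^sub>R e) - f x \<le> H ((x + t *\<^sub>R e) \<bullet> (x + t *\<^sub>R e)) - H (x \<bullet> x)"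
        by (rule eventually_along_line[OF touch \<open>e \<noteq> 0\<close>])
      have "((\<lambda>s. (H s - H (x \<bullet> x)) / (s - x \<bullet> x)) \<longlongrightarrow> q / 2) (at (x \<bullet> x) within {0..R\<^sup>2})"
        using H by (simp add: has_field_derivative_iff)
      moreover have "q / 2 < c / (2 * (e \<bullet> e))"
        using c(1) \<open>e \<noteq> 0\<close> by (simp add: field_simps)
      ultimately have *: "\<forall>\<^sub>F s in at (x \<bullet> x) within {0..R\<^sup>2}. (H s - H (x \<bullet> x)) / (s - x \<bullet> x) < c / (2 * (e \<bullet> e))"
        by (rule order_tendstoD)
      have sq: "(x + t *\<^sub>R e) \<bullet> (x + t *\<^sub>R e) = x \<bullet> x + t\<^sup>2 * (e \<bullet> e)" for t
        using \<open>e \<bullet> x = 0\<close> by (simp add: inner_add_left inner_add_right inner_commute power2_eq_square)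
      have "\<forall>\<^sub>F y in at x. y \<in> ball 0 R"
        using C2(2) open_ball by (intro eventually_at_in_open') auto
      then have ev: "\<forall>\<^sub>F t in at_right 0. x + t *\<^sub>R e \<in> ball 0 R"
        using \<open>e \<noteq> 0\<close> by (rule eventually_along_line)
      have "filterlim (\<lambda>t. (x + t *\<^sub>R e) \<bullet> (x + t *\<^sub>R e)) (at (x \<bullet> x) within {0..R\<^sup>2}) (at_right 0)"
        unfolding filterlim_at
      proof
        show "\<forall>\<^sub>F t in at_right 0. (x + t *\<^sub>R e) \<bullet> (x + t *\<^sub>R e) \<in> {0..R\<^sup>2} \<and> (x + t *\<^sub>R e) \<bullet> (x + t *\<^sub>R e) \<noteq> x \<bullet> x"
          using ev eventually_at_right_less[of 0]
        proof eventually_elim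
          case (elim t)
          then show ?case using in_range[OF elim(1)] \<open>e \<noteq> 0\<close> unfolding sq by simp
        qed
        show "((\<lambda>t. (x + t *\<^sub>R e) \<bullet> (x + t *\<^sub>R e)) \<longlongrightarrow> x \<bullet> x) (at_right 0)"
          by (auto intro!: tendsto_eq_intros)
      qed
      then have 3: "\<forall>\<^sub>F t in at_right 0. (H ((x + t *\<^sub>R e) \<bullet> (x + t *\<^sub>R e)) - H (x \<bullet> x)) /
          ((x + t *\<^sub>R e) \<bullet> (x + t *\<^sub>R e) - x \<bullet> x) < c / (2 * (e \<bullet> e))"
        using * by (rule eventually_compose_filterlim[rotated])
      have "\<forall>\<^sub>F t in at_right (0::real). False"
        using 1 2 3 eventually_at_right_less[of 0]
      proof eventually_elim
        case (elim t)
        have pos: "t\<^sup>2 * (e \<bullet> e) > 0" using elim(4) \<open>e \<noteq> 0\<close> by simp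
        have "H (x \<bullet> x + t\<^sup>2 * (e \<bullet> e)) - H (x \<bullet> x) < c / (2 * (e \<bullet> e)) * (t\<^sup>2 * (e \<bullet> e))"
          using elim(3) pos unfolding sq by (simp add: pos_divide_less_eq)
        also have "\<dots> = c / 2 * t\<^sup>2" using \<open>e \<noteq> 0\<close> by simp
        finally show ?case using elim(1,2) \<open>e \<bullet> x = 0\<close> unfolding sq grad by simp
      qed
      then show False by (simp add: trivial_limit_at_right_real)
    qed
  qed
qed

section \<open>The radial profile\<close>

text \<open>
Bernoulli's inequality: the convex function \<open>x powr p\<close> lies above its tangent at \<open>1\<close>.
\<close>

lemma powr_ge_tangent_at_1:
  fixes x p :: real
  assumes "0 \<le> x" "1 \<le> p"
  shows "1 + p * (x - 1) \<le> x powr p"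
proof (cases "x = 0")
  case False
  have "((\<lambda>x. x powr p) has_real_derivative p) (at 1 within {0<..})"
    by (auto intro!: derivative_eq_intros)
  from convex_on_imp_above_tangent[OF powr_convex[OF \<open>1 \<le> p\<close>] _ _ _ this, of x]
  show ?thesis using False \<open>0 \<le> x\<close> by (simp add: interior_open)
qed (use assms in auto)

text \<open>
The hypothesis \<open>p (r b)\<^sup>p \<le> b\<close> says that \<open>y \<mapsto> (r y)\<^sup>p\<close> has slope at most \<open>1\<close> at \<open>b\<close>, hence on all of
\<open>[0, b]\<close> by convexity.  The slope may equal \<open>1\<close> at \<open>b\<close> itself, so strictness needs \<open>y < b\<close>.
\<close>

lemma powr_slope_bound:
  fixes x y r b p :: real
  assumes p: "1 < p" and "0 \<le> r" "0 < b" and b: "p * (r * b) powr p \<le> b"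
    and xy: "0 \<le> x" "x < y" "y \<le> b"
  shows "(r * y) powr p - (r * x) powr p \<le> y - x"
    and "y < b \<Longrightarrow> (r * y) powr p - (r * x) powr p < y - x"
proof -
  have y: "y > 0" using xy by simp
  define \<theta> where "\<theta> = y / b"
  have \<theta>: "0 < \<theta>" "\<theta> \<le> 1" "y = \<theta> * b" using xy \<open>0 < b\<close> y by (auto simp: \<theta>_def)
  have "(r * y) powr p * (1 + p * (x / y - 1)) \<le> (r * y) powr p * (x / y) powr p"
    using powr_ge_tangent_at_1[of "x / y" p] xy p y by (intro mult_left_mono) auto
  also have "\<dots> = (r * x) powr p"
    using y xy \<open>0 \<le> r\<close> by (simp flip: powr_mult)
  finally have "(r * y) powr p - (r * x) powr p \<le> p * (r * y) powr p * ((y - x) / y)"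
    using y by (simp add: field_simps)
  moreover have "p * (r * y) powr p * ((y - x) / y) = \<theta> powr p * (p * (r * b) powr p) * ((y - x) / y)"
  proof -
    have "(r * y) powr p = \<theta> powr p * (r * b) powr p"
      using \<theta> \<open>0 \<le> r\<close> \<open>0 < b\<close> by (simp flip: powr_mult add: mult_ac)
    then show ?thesis by (simp add: mult_ac)
  qed
  ultimately have "(r * y) powr p - (r * x) powr p \<le> \<theta> powr p * (p * (r * b) powr p) * ((y - x) / y)"
    by linarith
  also have "\<dots> \<le> \<theta> powr p * b * ((y - x) / y)"
    using b xy y by (intro mult_right_mono mult_left_mono) auto
  finally have 1: "(r * y) powr p - (r * x) powr p \<le> \<theta> powr p * b * ((y - x) / y)" .
  have eq: "\<theta> * b * ((y - x) / y) = y - x" unfolding \<theta>(3)[symmetric] using y by simp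
  have "\<theta> powr p \<le> \<theta> powr 1" using \<theta> p by (intro powr_mono') auto
  then have "\<theta> powr p * b * ((y - x) / y) \<le> \<theta> * b * ((y - x) / y)"
    using \<theta> \<open>0 < b\<close> xy y by (intro mult_right_mono) auto
  then show "(r * y) powr p - (r * x) powr p \<le> y - x" using 1 eq by simp
  assume "y < b"
  then have "\<theta> < 1" using \<open>0 < b\<close> by (simp add: \<theta>_def)
  then have "\<theta> powr p < \<theta> powr 1" using \<theta> p by (intro powr_less_mono') auto
  then have "\<theta> powr p * b * ((y - x) / y) < \<theta> * b * ((y - x) / y)"
    using \<theta> \<open>0 < b\<close> xy y by (intro mult_strict_right_mono) auto
  then show "(r * y) powr p - (r * x) powr p < y - x" using 1 eq by simp
qed

lemma id_minus_powr_strict_mono: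
  fixes x y r b p :: real
  assumes "1 < p" "0 \<le> r" "0 < b" "p * (r * b) powr p \<le> b" "0 \<le> x" "x < y" "y \<le> b"
  shows "x - (r * x) powr p < y - (r * y) powr p"
proof -
  \<comment> \<open>The strict bound is available below \<open>b\<close> only, so the interval is split to allow \<open>y = b\<close>.\<close>
  obtain m where m: "x < m" "m < y" using \<open>x < y\<close> dense by blast
  have "(r * m) powr p - (r * x) powr p < m - x"
    using assms m by (intro powr_slope_bound(2)[of p r b x m]) auto
  moreover have "(r * y) powr p - (r * m) powr p \<le> y - m"
    using assms m by (intro powr_slope_bound(1)[of p r b m y]) auto
  ultimately show ?thesis by simp
qed

lemma integral_diff_bound:
  fixes h :: "real \<Rightarrow> real"
  assumes h: "continuous_on UNIV h" and M: "\<And>t. \<bar>h t\<bar> \<le> M"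
  shows "\<bar>integral {c..a} h - integral {c..b} h\<bar> \<le> M * \<bar>a - b\<bar>"
proof -
  have M0: "0 \<le> M" using M[of 0] by simp
  have int: "h integrable_on {x..y}" for x y
    using h by (intro integrable_continuous_interval continuous_on_subset[OF h]) auto
  have bd: "\<bar>integral {x..y} h\<bar> \<le> M * (y - x)" if "x \<le> y" for x y
    using integral_bound[OF that continuous_on_subset[OF h]] M by auto
  have main: "\<bar>integral {c..b} h - integral {c..a} h\<bar> \<le> M * (b - a)" if "a \<le> b" for a b
  proof (cases "c \<le> a")
    case True
    then have "integral {c..a} h + integral {a..b} h = integral {c..b} h"
      using that int by (intro Henstock_Kurzweil_Integration.integral_combine) auto
    then show ?thesis using bd[OF that] by simp
  next
    case False
    then have a: "integral {c..a} h = 0" by simp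
    show ?thesis
    proof (cases "c \<le> b")
      case True
      then have "\<bar>integral {c..b} h\<bar> \<le> M * (b - c)" by (rule bd)
      also have "\<dots> \<le> M * (b - a)" using M0 False by (intro mult_left_mono) auto
      finally show ?thesis using a by simp
    next
      case False
      then show ?thesis using a M0 that by simp
    qed
  qed
  show ?thesis
  proof (cases "a \<le> b")
    case True
    then show ?thesis using main[OF True] abs_minus_commute[of "integral {c..a} h"] by simp
  next
    case False
    then show ?thesis using main[of b a] by simp
  qed
qed

lemma bounded_slope_imp_continuous:
  fixes z :: "real \<Rightarrow> real"
  assumes "\<And>s t. \<bar>z s - z t\<bar> \<le> M * \<bar>s - t\<bar>"
  shows "continuous_on S z"
proof -
  have "0 \<le> M" using assms[of 0 1] by simp
  then have "M-lipschitz_on S z"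
    using assms by (auto simp: lipschitz_on_def dist_real_def)
  then show ?thesis by (rule lipschitz_on_continuous_on)
qed

lemma continuous_on_superposition:
  fixes F :: "real \<Rightarrow> real \<Rightarrow> real"
  assumes "continuous_on UNIV (\<lambda>(t, z). F t z)" "continuous_on S z"
  shows "continuous_on S (\<lambda>s. F s (z s))"
proof -
  have "continuous_on S (\<lambda>s. (s, z s))"
    using assms(2) by (intro continuous_intros)
  from continuous_on_compose2[OF assms(1) this] show ?thesis by simp
qed

text \<open>
Tonelli's approximation: with the delay \<open>\<delta>\<close> the right-hand side at time \<open>t\<close> involves \<open>z\<close> only up to
\<open>t - \<delta>\<close>, so one evaluation of the integral extends a solution from \<open>(-\<infinity>, k \<delta>]\<close> to \<open>(-\<infinity>, (k + 1) \<delta>]\<close>.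
\<close>

lemma delayed_integral_equation:
  fixes F :: "real \<Rightarrow> real \<Rightarrow> real"
  assumes F: "continuous_on UNIV (\<lambda>(t, z). F t z)" and M: "\<And>t z. \<bar>F t z\<bar> \<le> M" and "0 < \<delta>"
  obtains z where "\<And>s t. \<bar>z s - z t\<bar> \<le> M * \<bar>s - t\<bar>"
    and "\<And>t. t \<le> A \<Longrightarrow> z t = integral {0..t - \<delta>} (\<lambda>s. F s (z s))"
proof -
  have M0: "0 \<le> M" using M[of 0 0] by linarith
  have ex: "\<exists>z. (\<forall>s t. \<bar>z s - z t\<bar> \<le> M * \<bar>s - t\<bar>) \<and>
      (\<forall>t \<le> of_nat k * \<delta>. z t = integral {0..t - \<delta>} (\<lambda>s. F s (z s)))" for k
  proof (induction k)
    case 0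
    have "integral {0..t - \<delta>} (\<lambda>s. F s 0) = 0" if "t \<le> 0" for t
      using that \<open>0 < \<delta>\<close> by simp
    then show ?case using M0 by (intro exI[of _ "\<lambda>_. 0"]) auto
  next
    case (Suc k)
    then obtain z where z: "\<And>s t. \<bar>z s - z t\<bar> \<le> M * \<bar>s - t\<bar>"
      and eq: "\<And>t. t \<le> of_nat k * \<delta> \<Longrightarrow> z t = integral {0..t - \<delta>} (\<lambda>s. F s (z s))" by blast
    define w where "w = (\<lambda>t. integral {0..t - \<delta>} (\<lambda>s. F s (z s)))"
    have "continuous_on UNIV z" using z by (rule bounded_slope_imp_continuous)
    then have "continuous_on UNIV (\<lambda>s. F s (z s))"
      by (rule continuous_on_superposition[OF F])
    then have "\<bar>w s - w t\<bar> \<le> M * \<bar>s - t\<bar>" for s t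
      using integral_diff_bound[of "\<lambda>s. F s (z s)" M 0 "s - \<delta>" "t - \<delta>"] M by (simp add: w_def)
    moreover have "w t = integral {0..t - \<delta>} (\<lambda>s. F s (w s))" if "t \<le> of_nat (Suc k) * \<delta>" for t
    proof -
      have "w s = z s" if "s \<le> t - \<delta>" for s
        using eq[of s] that \<open>t \<le> of_nat (Suc k) * \<delta>\<close> by (simp add: w_def algebra_simps)
      then have "integral {0..t - \<delta>} (\<lambda>s. F s (w s)) = integral {0..t - \<delta>} (\<lambda>s. F s (z s))"
        by (intro Henstock_Kurzweil_Integration.integral_cong) auto
      then show ?thesis by (simp add: w_def)
    qed
    ultimately show ?case by blast
  qed
  obtain k :: nat where "A / \<delta> < of_nat k" using reals_Archimedean2 by blast
  then have "A \<le> of_nat k * \<delta>" using \<open>0 < \<delta>\<close> by (simp add: field_simps)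
  then show ?thesis using ex[of k] that by (meson order_trans)
qed

text \<open>
The delayed solutions are uniformly Lipschitz; a limit along a subsequence as the delay tends
to zero solves the integral equation.
\<close>

lemma peano_existence:
  fixes F :: "real \<Rightarrow> real \<Rightarrow> real"
  assumes F: "continuous_on UNIV (\<lambda>(t, z). F t z)" and M: "\<And>t z. \<bar>F t z\<bar> \<le> M" and A: "0 \<le> A"
  obtains z where "continuous_on {0..A} z"
    and "\<And>t. t \<in> {0..A} \<Longrightarrow> z t = integral {0..t} (\<lambda>s. F s (z s))"
proof -
  have M0: "0 \<le> M" using M[of 0 0] by linarith
  have "\<exists>z. (\<forall>s t. \<bar>z s - z t\<bar> \<le> M * \<bar>s - t\<bar>) \<and>
      (\<forall>t \<le> A. z t = integral {0..t - 1 / of_nat (Suc n)} (\<lambda>s. F s (z s)))" for n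
    using delayed_integral_equation[OF F M, of "1 / of_nat (Suc n)" A] by (metis zero_less_divide_1_iff of_nat_0_less_iff zero_less_Suc)
  then obtain Z where lip: "\<And>n s t. \<bar>Z n s - Z n t\<bar> \<le> M * \<bar>s - t\<bar>"
    and Z: "\<And>n t. t \<le> A \<Longrightarrow> Z n t = integral {0..t - 1 / of_nat (Suc n)} (\<lambda>s. F s (Z n s))" by metis
  have Z0: "Z n 0 = 0" for n using Z[of 0 n] A by simp
  have FZ: "continuous_on S (\<lambda>s. F s (Z n s))" for n S
  proof -
    have "continuous_on S (Z n)" using lip by (rule bounded_slope_imp_continuous)
    then show ?thesis by (rule continuous_on_superposition[OF F])
  qed
  have bd: "norm (Z n t) \<le> M * A" if "t \<in> {0..A}" for n t
  proof -
    have "\<bar>Z n t\<bar> \<le> M * \<bar>t\<bar>" using lip[of n t 0] Z0 by simp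
    also have "\<dots> \<le> M * A" using that M0 by (intro mult_left_mono) auto
    finally show ?thesis by simp
  qed
  have equi: "\<exists>d. 0 < d \<and> (\<forall>n y. y \<in> {0..A} \<and> norm (x - y) < d \<longrightarrow> norm (Z n x - Z n y) < e)"
    if "0 < e" for x e :: real
  proof (intro exI conjI allI impI)
    show "0 < e / (M + 1)" using M0 that by simp
    fix n y assume "y \<in> {0..A} \<and> norm (x - y) < e / (M + 1)"
    then have "\<bar>x - y\<bar> * (M + 1) < e" using M0 by (simp add: pos_less_divide_eq)
    then have "M * \<bar>x - y\<bar> < e" by (simp add: algebra_simps)
    then show "norm (Z n x - Z n y) < e" using lip[of n x y] by simp
  qed
  obtain z k where z: "continuous_on {0..A} z" and k: "strict_mono (k :: nat \<Rightarrow> nat)"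
    and conv: "\<And>e. 0 < e \<Longrightarrow> \<exists>N. \<forall>n x. n \<ge> N \<and> x \<in> {0..A} \<longrightarrow> norm (Z (k n) x - z x) < e"
    by (rule Arzela_Ascoli[of "{0..A}" Z, OF compact_Icc bd equi]) (assumption | blast)+
  have lim: "(\<lambda>n. Z (k n) x) \<longlonglongrightarrow> z x" if "x \<in> {0..A}" for x
    unfolding LIMSEQ_iff using conv that by blast
  have "z t = integral {0..t} (\<lambda>s. F s (z s))" if t: "t \<in> {0..A}" for t
  proof (rule LIMSEQ_unique[OF lim[OF t]])
    have int: "(\<lambda>n. integral {0..t} (\<lambda>s. F s (Z (k n) s))) \<longlonglongrightarrow> integral {0..t} (\<lambda>s. F s (z s))"
    proof (rule dominated_convergence(2)[where h="\<lambda>_. M"])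
      show "(\<lambda>s. F s (Z (k n) s)) integrable_on {0..t}" for n
        using FZ by (rule integrable_continuous_interval)
      show "(\<lambda>n. F s (Z (k n) s)) \<longlonglongrightarrow> F s (z s)" if "s \<in> {0..t}" for s
      proof -
        have "isCont (\<lambda>(t, z). F t z) (s, z s)"
          using F by (simp add: continuous_on_eq_continuous_at)
        moreover have "(\<lambda>n. (s, Z (k n) s)) \<longlonglongrightarrow> (s, z s)"
          using lim[of s] that t by (intro tendsto_intros) auto
        ultimately have "(\<lambda>n. case (s, Z (k n) s) of (t, z) \<Rightarrow> F t z) \<longlonglongrightarrow> (case (s, z s) of (t, z) \<Rightarrow> F t z)"
          by (rule isCont_tendsto_compose)
        then show ?thesis by simp
      qed
    qed (use M in auto)
    have diff: "(\<lambda>n. Z (k n) t - integral {0..t} (\<lambda>s. F s (Z (k n) s))) \<longlonglongrightarrow> 0"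
    proof (rule Lim_null_comparison)
      show "\<forall>\<^sub>F n in sequentially. norm (Z (k n) t - integral {0..t} (\<lambda>s. F s (Z (k n) s))) \<le> M * (1 / of_nat (Suc (k n)))"
      proof (rule always_eventually, rule allI)
        fix n
        show "norm (Z (k n) t - integral {0..t} (\<lambda>s. F s (Z (k n) s))) \<le> M * (1 / of_nat (Suc (k n)))"
          using integral_diff_bound[OF FZ[of UNIV "k n"] M, of 0 "t - 1 / of_nat (Suc (k n))" t] Z[of t "k n"] t
          by simp
      qed
      have "(\<lambda>n. 1 / of_nat (Suc n)) \<longlonglongrightarrow> (0::real)" by (rule lim_1_over_n[THEN LIMSEQ_Suc])
      from LIMSEQ_subseq_LIMSEQ[OF this k]
      show "(\<lambda>n. M * (1 / of_nat (Suc (k n)))) \<longlonglongrightarrow> 0"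
        by (intro tendsto_mult_right_zero) (simp add: o_def)
    qed
    from tendsto_add[OF diff int] show "(\<lambda>n. Z (k n) t) \<longlonglongrightarrow> integral {0..t} (\<lambda>s. F s (z s))"
      by simp
  qed
  then show ?thesis using that z by blast
qed

text \<open>
Up to the critical radius, \<open>q \<mapsto> q - (r q)\<^sup>p\<close> increases on the fixed interval \<open>[0, b]\<close> and reaches at
least \<open>C\<close> at its right end.  At the critical radius itself \<open>b\<close> is the double root of
\<open>q - (r q)\<^sup>p = C\<close>.
\<close>

lemma critical_slope_bound:
  fixes p C r R :: real
  defines "b \<equiv> p * C / (p - 1)"
  assumes p: "1 < p" and C: "0 < C" and R: "(R * b) powr p \<le> C / (p - 1)" and r: "0 \<le> r" "r \<le> R"
  shows "p * (r * b) powr p \<le> b" and "C \<le> b - (r * b) powr p"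
proof -
  have b: "b > 0" using p C by (simp add: b_def)
  have "(r * b) powr p \<le> (R * b) powr p"
    using r b p by (intro powr_mono2 mult_right_mono) auto
  then have *: "(r * b) powr p \<le> C / (p - 1)" using R by simp
  have "p * (r * b) powr p \<le> p * (C / (p - 1))"
    using * p by (intro mult_left_mono) auto
  then show "p * (r * b) powr p \<le> b" by (simp add: b_def)
  have "b - C / (p - 1) = C * (p - 1) / (p - 1)"
    by (simp add: b_def diff_divide_distrib[symmetric] algebra_simps)
  then have "C = b - C / (p - 1)" using p by simp
  then show "C \<le> b - (r * b) powr p" using * by simp
qed

text \<open>
At the double root the implicit function theorem fails.  Continuity up to and including that
point comes from uniqueness of the root in a compact interval and closedness of the graph.
\<close>

lemma continuous_small_root:
  fixes p C R :: real
  defines "b \<equiv> p * C / (p - 1)"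
  assumes p: "1 < p" and C: "0 < C" and R: "(R * b) powr p \<le> C / (p - 1)"
  shows "\<exists>Q. continuous_on ({0..R} \<times> {0..C}) Q \<and>
    (\<forall>r \<in> {0..R}. \<forall>h \<in> {0..C}. Q (r, h) \<in> {0..b} \<and> Q (r, h) - (r * Q (r, h)) powr p = h)"
proof -
  have b: "b > 0" using p C by (simp add: b_def)
  note slope = critical_slope_bound[OF p C R[unfolded b_def], folded b_def]
  let ?D = "{0..R} \<times> {0..C}"
  have ex: "\<exists>q \<in> {0..b}. q - (r * q) powr p = h" if "r \<in> {0..R}" "h \<in> {0..C}" for r h
  proof -
    have "\<exists>q\<ge>0. q \<le> b \<and> q - (r * q) powr p = h"
    proof (rule IVT')
      show "0 - (r * 0) powr p \<le> h" using that by simp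
      show "h \<le> b - (r * b) powr p" using slope(2)[of r] that by simp
      show "continuous_on {0..b} (\<lambda>q. q - (r * q) powr p)"
        using that p by (intro continuous_intros continuous_on_powr') (auto simp: mult_nonneg_nonneg)
    qed (use b in simp)
    then show ?thesis by auto
  qed
  have "\<forall>z\<in>?D. \<exists>q. q \<in> {0..b} \<and> q - (fst z * q) powr p = snd z"
  proof
    fix z assume "z \<in> ?D"
    then have "fst z \<in> {0..R}" "snd z \<in> {0..C}" by auto
    from ex[OF this] show "\<exists>q. q \<in> {0..b} \<and> q - (fst z * q) powr p = snd z" by blast
  qed
  from bchoice[OF this] obtain Q
    where Q_all: "\<forall>z\<in>?D. Q z \<in> {0..b} \<and> Q z - (fst z * Q z) powr p = snd z" ..
  note Q = bspec[OF Q_all]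
  have unique: "q = Q (r, h)"
    if "r \<in> {0..R}" "h \<in> {0..C}" "q \<in> {0..b}" "q - (r * q) powr p = h" for r h q
  proof -
    have Qrh: "Q (r, h) \<in> {0..b}" "Q (r, h) - (r * Q (r, h)) powr p = h"
      using Q[of "(r, h)"] that by auto
    show ?thesis
    proof (cases q "Q (r, h)" rule: linorder_cases)
      case less
      then have "q - (r * q) powr p < Q (r, h) - (r * Q (r, h)) powr p"
        using that Qrh p b slope(1)[of r] by (intro id_minus_powr_strict_mono[where b=b]) auto
      then show ?thesis using that Qrh by simp
    next
      case greater
      then have "Q (r, h) - (r * Q (r, h)) powr p < q - (r * q) powr p"
        using that Qrh p b slope(1)[of r] by (intro id_minus_powr_strict_mono[where b=b]) auto
      then show ?thesis using that Qrh by simp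
    qed simp
  qed
  have "continuous_on ?D Q"
  proof (rule continuous_from_closed_graph[of "{0..b}"])
    show "compact {0..b}" by simp
    show "Q \<in> ?D \<rightarrow> {0..b}"
      by (rule Pi_I) (use Q in blast)
    define G where "G = {w \<in> ?D \<times> {0..b}. (\<lambda>((r, h), q). q - (r * q) powr p - h) w = 0}"
    have "continuous_on (?D \<times> {0..b}) (\<lambda>((r, h), q). q - (r * q) powr p - h)"
      using p unfolding case_prod_unfold
      by (intro continuous_intros continuous_on_powr') (auto simp: mult_nonneg_nonneg)
    then have "closed G" unfolding G_def
      by (rule continuous_closed_preimage_constant) (simp add: closed_Times)
    moreover have "(\<lambda>x. (x, Q x)) ` ?D = G"
    proof
      show "(\<lambda>x. (x, Q x)) ` ?D \<subseteq> G"
      proof (rule image_subsetI)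
        fix z assume "z \<in> ?D"
        from Q[OF this] this show "(z, Q z) \<in> G"
          unfolding G_def case_prod_unfold by simp
      qed
      show "G \<subseteq> (\<lambda>x. (x, Q x)) ` ?D"
      proof
        fix w assume "w \<in> G"
        then have w: "fst w \<in> ?D" "snd w \<in> {0..b}"
            "snd w - (fst (fst w) * snd w) powr p = snd (fst w)"
          unfolding G_def case_prod_unfold by auto
        then have "snd w = Q (fst w)"
          using unique[of "fst (fst w)" "snd (fst w)" "snd w"] by (auto simp: mem_Times_iff)
        then have "w = (fst w, Q (fst w))" by (metis prod.collapse)
        then show "w \<in> (\<lambda>x. (x, Q x)) ` ?D" using w(1) by (rule image_eqI)
      qed
    qed
    ultimately show "closed ((\<lambda>x. (x, Q x)) ` ?D)" by simp
  qed
  moreover have "Q (r, h) \<in> {0..b} \<and> Q (r, h) - (r * Q (r, h)) powr p = h"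
    if "r \<in> {0..R}" "h \<in> {0..C}" for r h
    using Q[of "(r, h)"] that by simp
  ultimately show ?thesis by blast
qed

text \<open>
The ODE is degenerate at \<open>s = R\<^sup>2\<close> when the radius is critical, which is why existence is taken from
Peano's theorem, in the reversed time \<open>t = R\<^sup>2 - s\<close>, for the right-hand side given by the
smaller root \<open>Q\<close>.  The arguments of \<open>Q\<close> are first clamped to its domain; afterwards the clamps
turn out to be inactive, since \<open>z\<close> decreases from \<open>0\<close> and stops decreasing where
\<open>\<gamma> z + C\<close> reaches \<open>0\<close>.
\<close>

lemma radial_profile_exists:
  fixes p C R \<gamma> :: real
  defines "b \<equiv> p * C / (p - 1)"
  assumes p: "1 < p" and C: "0 < C" and "0 < R" and \<gamma>: "0 \<le> \<gamma>"
    and R: "(R * b) powr p \<le> C / (p - 1)"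
  obtains H q :: "real \<Rightarrow> real"
  where "H (R\<^sup>2) = 0"
    and "\<And>s. s \<in> {0..R\<^sup>2} \<Longrightarrow> (H has_real_derivative q s / 2) (at s within {0..R\<^sup>2})"
    and "\<And>s. s \<in> {0..R\<^sup>2} \<Longrightarrow> 0 \<le> q s \<and> q s \<le> b"
    and "\<And>s. s \<in> {0..R\<^sup>2} \<Longrightarrow> q s = (q s * sqrt s) powr p + \<gamma> * H s + C"
    and "\<And>s t. 0 \<le> s \<Longrightarrow> s \<le> t \<Longrightarrow> t \<le> R\<^sup>2 \<Longrightarrow> q s \<le> q t"
proof -
  have b: "b > 0" using p C by (simp add: b_def)
  note slope = critical_slope_bound[OF p C R[unfolded b_def], folded b_def]
  obtain Q where contQ: "continuous_on ({0..R} \<times> {0..C}) Q"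
    and Q_all: "\<forall>r \<in> {0..R}. \<forall>h \<in> {0..C}. Q (r, h) \<in> {0..b} \<and> Q (r, h) - (r * Q (r, h)) powr p = h"
    using continuous_small_root[OF p C R[unfolded b_def], folded b_def] by blast
  note Q = Q_all[rule_format]
  \<comment> \<open>The clamped arguments of \<open>Q\<close>, total and continuous on the whole line.\<close>
  define \<rho> where "\<rho> = (\<lambda>t. sqrt (max 0 (min (R\<^sup>2) (R\<^sup>2 - t))))"
  define \<eta> where "\<eta> = (\<lambda>z. max 0 (min C (\<gamma> * z + C)))"
  have \<rho>: "\<rho> t \<in> {0..R}" for t
    using \<open>0 < R\<close> by (auto simp: \<rho>_def intro: real_le_lsqrt)
  have \<eta>: "\<eta> z \<in> {0..C}" for z using C by (auto simp: \<eta>_def)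
  define F where "F = (\<lambda>t z. - Q (\<rho> t, \<eta> z) / 2)"
  have contF: "continuous_on UNIV (\<lambda>(t, z). F t z)"
  proof -
    have "continuous_on UNIV (\<lambda>(t, z). Q (\<rho> t, \<eta> z))" unfolding case_prod_unfold
    proof (rule continuous_on_compose2[OF contQ])
      show "continuous_on UNIV (\<lambda>w. (\<rho> (fst w), \<eta> (snd w)))"
        unfolding \<rho>_def \<eta>_def by (intro continuous_intros)
    qed (use \<rho> \<eta> in auto)
    then show ?thesis unfolding F_def case_prod_unfold by (auto intro!: continuous_intros)
  qed
  have F: "F t z \<le> 0" "\<bar>F t z\<bar> \<le> b" for t z
  proof -
    have "Q (\<rho> t, \<eta> z) \<in> {0..b}" using Q[OF \<rho> \<eta>] by blast
    then show "F t z \<le> 0" "\<bar>F t z\<bar> \<le> b" using b by (simp_all add: F_def)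
  qed
  obtain z where z: "continuous_on {0..R\<^sup>2} z" "\<And>t. t \<in> {0..R\<^sup>2} \<Longrightarrow> z t = integral {0..t} (\<lambda>s. F s (z s))"
    using peano_existence[OF contF F(2), of "R\<^sup>2"] by auto
  have cFz: "continuous_on {0..R\<^sup>2} (\<lambda>s. F s (z s))"
    by (rule continuous_on_superposition[OF contF z(1)])
  have der: "(z has_real_derivative F t (z t)) (at t within {0..R\<^sup>2})" if "t \<in> {0..R\<^sup>2}" for t
  proof -
    have "((\<lambda>t. integral {0..t} (\<lambda>s. F s (z s))) has_real_derivative F t (z t)) (at t within {0..R\<^sup>2})"
      using integral_has_real_derivative[OF cFz that] .
    then show ?thesis
      unfolding has_field_derivative_def by (rule has_derivative_transform[OF that z(2), rotated])
  qed
  have z0: "z 0 = 0" using z(2)[of 0] by simp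
  have mvt: "\<exists>x. s < x \<and> x < t \<and> z t - z s = (t - s) * F x (z x)" if "0 \<le> s" "s < t" "t \<le> R\<^sup>2" for s t
  proof -
    have "(z has_derivative (\<lambda>h. F x (z x) * h)) (at x within {s..t})" if "s \<le> x" "x \<le> t" for x
    proof -
      have "(z has_real_derivative F x (z x)) (at x within {s..t})"
        by (rule DERIV_subset[OF der]) (use that \<open>0 \<le> s\<close> \<open>t \<le> R\<^sup>2\<close> in auto)
      then show ?thesis by (simp add: has_field_derivative_def)
    qed
    from mvt_simple[OF \<open>s < t\<close> this] have "\<exists>x\<in>{s<..<t}. z t - z s = F x (z x) * (t - s)" by blast
    then show ?thesis by (auto simp: mult.commute)
  qed
  have decr: "z t \<le> z s" if "0 \<le> s" "s \<le> t" "t \<le> R\<^sup>2" for s t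
  proof (cases "s = t")
    case False
    then have "s < t" using that(2) by simp
    from mvt[OF that(1) this that(3)] obtain x where "z t - z s = (t - s) * F x (z x)" by blast
    moreover have "(t - s) * F x (z x) \<le> 0" using F(1) that by (intro mult_nonneg_nonpos) auto
    ultimately show ?thesis by simp
  qed simp
  have zle0: "z t \<le> 0" if "t \<in> {0..R\<^sup>2}" for t using decr[of 0 t] that z0 by simp
  have lower: "0 \<le> \<gamma> * z t + C" if t: "t \<in> {0..R\<^sup>2}" for t
  proof (rule ccontr)
    assume neg: "\<not> 0 \<le> \<gamma> * z t + C"
    define K where "K = {0..t} \<inter> (\<lambda>s. \<gamma> * z s + C) -` {0..}"
    have "continuous_on {0..t} (\<lambda>s. \<gamma> * z s + C)"
      using t by (intro continuous_intros continuous_on_subset[OF z(1)]) auto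
    then have "closed K" unfolding K_def by (rule continuous_closed_preimage) auto
    moreover have "bounded K" unfolding K_def by (rule bounded_subset[OF bounded_closed_interval]) auto
    ultimately have "compact K" by (simp add: compact_eq_bounded_closed)
    moreover have "0 \<in> K" using z0 C t by (simp add: K_def)
    ultimately obtain s where s: "s \<in> K" "\<forall>s'\<in>K. s' \<le> s"
      using compact_attains_sup[of K] by blast
    have "s \<noteq> t" using s(1) neg by (auto simp: K_def)
    then have "0 \<le> s" "s < t" "t \<le> R\<^sup>2" using s(1) t by (auto simp: K_def)
    from mvt[OF this] obtain x where x: "s < x" "x < t" "z t - z s = (t - s) * F x (z x)" by blast
    have "x \<notin> K" using s(2) x(1) by auto
    then have "\<gamma> * z x + C < 0" using x \<open>0 \<le> s\<close> by (auto simp: K_def)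
    then have "\<eta> (z x) = 0" using C by (simp add: \<eta>_def)
    have "Q (\<rho> x, 0) = 0"
    proof (rule ccontr)
      assume "Q (\<rho> x, 0) \<noteq> 0"
      then have "0 - (\<rho> x * 0) powr p < Q (\<rho> x, 0) - (\<rho> x * Q (\<rho> x, 0)) powr p"
        using p b \<rho>[of x] slope(1)[of "\<rho> x"] Q[OF \<rho>[of x], of 0] C
        by (intro id_minus_powr_strict_mono[where b=b]) auto
      then show False using Q[OF \<rho>[of x], of 0] C by simp
    qed
    then have "F x (z x) = 0" using \<open>\<eta> (z x) = 0\<close> by (simp add: F_def)
    then have "z t = z s" using x(3) by simp
    then show False using s(1) neg by (simp add: K_def)
  qed
  define H where "H = (\<lambda>s. z (R\<^sup>2 - s))"
  define q where "q = (\<lambda>s. Q (sqrt s, \<gamma> * H s + C))"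
  have mem: "sqrt s \<in> {0..R}" "\<gamma> * H s + C \<in> {0..C}" if "s \<in> {0..R\<^sup>2}" for s
    using that \<open>0 < R\<close> lower[of "R\<^sup>2 - s"] zle0[of "R\<^sup>2 - s"] \<gamma>
    by (auto simp: H_def intro: real_le_lsqrt mult_nonneg_nonpos)
  have Fq: "F (R\<^sup>2 - s) (z (R\<^sup>2 - s)) = - q s / 2" if "s \<in> {0..R\<^sup>2}" for s
  proof -
    have "\<rho> (R\<^sup>2 - s) = sqrt s" using that by (simp add: \<rho>_def)
    moreover have "\<eta> (z (R\<^sup>2 - s)) = \<gamma> * H s + C"
      using mem(2)[OF that] by (simp add: \<eta>_def H_def)
    ultimately show ?thesis by (simp add: F_def q_def)
  qed
  have Qq: "0 \<le> q s \<and> q s \<le> b \<and> q s - (sqrt s * q s) powr p = \<gamma> * H s + C" if "s \<in> {0..R\<^sup>2}" for s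
    using Q[OF mem(1)[OF that] mem(2)[OF that]] by (simp add: q_def)
  have incr: "H s \<le> H t" if "0 \<le> s" "s \<le> t" "t \<le> R\<^sup>2" for s t
    unfolding H_def using that by (intro decr) auto
  show ?thesis
  proof (rule that[of H q])
    show "H (R\<^sup>2) = 0" using z0 by (simp add: H_def)
    fix s assume s: "s \<in> {0..R\<^sup>2}"
    have refl: "((\<lambda>s. R\<^sup>2 - s) has_real_derivative - 1) (at s within {0..R\<^sup>2})"
      by (auto intro!: derivative_eq_intros)
    have "(z has_real_derivative F (R\<^sup>2 - s) (z (R\<^sup>2 - s))) (at (R\<^sup>2 - s) within (\<lambda>s. R\<^sup>2 - s) ` {0..R\<^sup>2})"
      by (rule DERIV_subset[OF der]) (use s in auto)
    from DERIV_image_chain[OF this refl]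
    have "(H has_real_derivative (F (R\<^sup>2 - s) (z (R\<^sup>2 - s)) * - 1)) (at s within {0..R\<^sup>2})"
      by (simp add: H_def o_def)
    then show "(H has_real_derivative q s / 2) (at s within {0..R\<^sup>2})"
      using Fq[OF s] by simp
    show "0 \<le> q s \<and> q s \<le> b" using Qq[OF s] by simp
    show "q s = (q s * sqrt s) powr p + \<gamma> * H s + C"
      using Qq[OF s] by (simp add: mult.commute)
  next
    fix s t assume st: "0 \<le> s" "s \<le> t" "t \<le> R\<^sup>2"
    have s: "s \<in> {0..R\<^sup>2}" and t: "t \<in> {0..R\<^sup>2}" using st by auto
    show "q s \<le> q t"
    proof (rule ccontr)
      assume "\<not> q s \<le> q t"
      then have "q t - (sqrt t * q t) powr p < q s - (sqrt t * q s) powr p"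
        using p b slope(1)[of "sqrt t"] mem(1)[OF t] Qq[OF s] Qq[OF t]
        by (intro id_minus_powr_strict_mono[where b=b]) auto
      moreover have "(sqrt s * q s) powr p \<le> (sqrt t * q s) powr p"
        using st p Qq[OF s] by (intro powr_mono2 mult_right_mono) auto
      moreover have "\<gamma> * H s + C \<le> \<gamma> * H t + C"
        using incr[OF st] \<gamma> by (simp add: mult_left_mono)
      ultimately show False using Qq[OF s] Qq[OF t] by simp
    qed
  qed
qed

section \<open>Testing and doubling for viscosity solutions\<close>

text \<open>
The Hessian of \<open>K (|y|\<^sup>2 - b)\<^sup>2\<close> at \<open>x\<close> acts on the hyperplane orthogonal to \<open>x\<close> as multiplication by \<open>t\<close>,
and its gradient is \<open>t x\<close>.
\<close>

lemma subsolution_quartic_test: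
  fixes v :: "real^'n \<Rightarrow> real" and x :: "real^'n"
  assumes sub: "visc_subsolution i p \<gamma> (\<lambda>_. - C) (ball 0 R) v" and i: "1 \<le> i" "i < CARD('n)"
    and x: "x \<in> ball 0 R"
    and max: "\<And>y. y \<in> ball 0 R \<Longrightarrow> v y - K * (y \<bullet> y - b)\<^sup>2 \<le> v x - K * (x \<bullet> x - b)\<^sup>2"
  defines "t \<equiv> 4 * K * (x \<bullet> x - b)"
  shows "(\<bar>t\<bar> * norm x) powr p + \<gamma> * v x + C \<le> t"
proof -
  define \<phi> where "\<phi> = (\<lambda>y::real^'n. K * (y \<bullet> y)\<^sup>2 + (- 2 * K * b) * (y \<bullet> y) + K * b\<^sup>2)"
  have \<phi>: "\<phi> y = K * (y \<bullet> y - b)\<^sup>2" for y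
    by (simp add: \<phi>_def power2_eq_square algebra_simps)
  have C2: "C2_on (ball 0 R) \<phi>" unfolding \<phi>_def by (rule C2_on_radial_quartic)
  have "local_max_on (ball 0 R) (\<lambda>y. v y - \<phi> y) x"
    unfolding local_max_on_def eventually_at_filter using x max by (auto simp: \<phi>)
  then have "- eigval i (hessian \<phi> x) + norm (gradient \<phi> x) powr p + \<gamma> * v x \<le> - C"
    using sub C2 unfolding visc_subsolution_def by blast
  moreover have "gradient \<phi> x = t *\<^sub>R x"
    unfolding \<phi>_def gradient_radial_quartic t_def by (simp add: algebra_simps)
  moreover have "eigval i (hessian \<phi> x) \<le> t"
  proof (rule eigval_le[OF transpose_hessian[OF C2 open_ball x] i])
    fix e :: "real^'n" assume "e \<bullet> x = 0"
    then show "e \<bullet> (hessian \<phi> x *v e) \<le> t * (e \<bullet> e)"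
      unfolding \<phi>_def hessian_radial_quartic t_def
      by (simp add: inner_add_right algebra_simps)
  qed
  ultimately show ?thesis by simp
qed

lemma supersolution_quadratic_test:
  fixes v :: "real^'n \<Rightarrow> real" and x :: "real^'n"
  assumes super: "visc_supersolution i p \<gamma> (\<lambda>_. - C) (ball 0 R) v" and i: "1 \<le> i" "i \<le> CARD('n)"
    and x: "x \<in> ball 0 R"
    and min: "\<And>y. y \<in> ball 0 R \<Longrightarrow> v x - c / 2 * (x \<bullet> x) \<le> v y - c / 2 * (y \<bullet> y)"
  shows "c \<le> (\<bar>c\<bar> * norm x) powr p + \<gamma> * v x + C"
proof -
  define \<phi> where "\<phi> = (\<lambda>y::real^'n. 0 * (y \<bullet> y)\<^sup>2 + c / 2 * (y \<bullet> y) + 0)"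
  have \<phi>: "\<phi> y = c / 2 * (y \<bullet> y)" for y by (simp add: \<phi>_def)
  have C2: "C2_on (ball 0 R) \<phi>" unfolding \<phi>_def by (rule C2_on_radial_quartic)
  have "local_min_on (ball 0 R) (\<lambda>y. v y - \<phi> y) x"
    unfolding local_min_on_def eventually_at_filter using x min by (auto simp: \<phi>)
  then have "- C \<le> - eigval i (hessian \<phi> x) + norm (gradient \<phi> x) powr p + \<gamma> * v x"
    using super C2 unfolding visc_supersolution_def by blast
  moreover have "gradient \<phi> x = c *\<^sub>R x"
    unfolding \<phi>_def gradient_radial_quartic by simp
  moreover have "c \<le> eigval i (hessian \<phi> x)"
  proof (rule eigval_ge[OF transpose_hessian[OF C2 open_ball x] i])
    fix e :: "real^'n"
    show "c * (e \<bullet> e) \<le> e \<bullet> (hessian \<phi> x *v e)"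
      unfolding \<phi>_def hessian_radial_quartic by simp
  qed
  ultimately show ?thesis by simp
qed

lemma inner_self_le_square: "norm x \<le> R \<Longrightarrow> x \<bullet> x \<in> {0..R\<^sup>2}"
  using power_mono[of "norm x" R 2] by (simp flip: power2_norm_eq_inner)

text \<open>
Comparison from above with a radial function whose profile \<open>G\<close> is only assumed differentiable.  At a
maximum of \<open>v x - G s - K (|x|\<^sup>2 - s)\<^sup>2\<close> let \<open>t = 4 K (|x|\<^sup>2 - s)\<close> be the radial slope of the
penalty in \<open>x\<close>.  Stationarity in \<open>s\<close> gives \<open>t = k s \<ge> 0\<close>, hence \<open>s \<le> |x|\<^sup>2\<close>: the point \<open>x\<close> lies
outside the sphere with radius \<open>\<surd>s\<close>, and so \<open>(t |x|)\<^sup>p \<ge> (k s \<surd>s)\<^sup>p\<close>.  For this sign reason a single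
large \<open>K\<close> suffices and no limit \<open>K \<rightarrow> \<infinity>\<close> has to be taken.
\<close>

lemma subsolution_doubling:
  fixes v :: "real^'n \<Rightarrow> real" and G k :: "real \<Rightarrow> real"
  assumes sub: "visc_subsolution i p \<gamma> (\<lambda>_. - C) (ball 0 R) v" and i: "1 \<le> i" "i < CARD('n)"
    and p: "0 \<le> p" and "0 < R"
    and cont: "continuous_on (cball 0 R) v" and bdry: "\<And>x. x \<in> sphere 0 R \<Longrightarrow> v x = 0"
    and GR: "G (R\<^sup>2) = 0"
    and G: "\<And>s. s \<in> {0..R\<^sup>2} \<Longrightarrow> (G has_real_derivative k s / 2) (at s within {0..R\<^sup>2})"
    and k: "\<And>s. s \<in> {0..R\<^sup>2} \<Longrightarrow> 0 \<le> k s \<and> k s \<le> B"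
    and x1: "x1 \<in> cball 0 R" "G (x1 \<bullet> x1) < v x1"
  obtains x s where "x \<in> ball 0 R" "0 \<le> s" "s < R\<^sup>2" "G s < v x"
    "(k s * sqrt s) powr p + \<gamma> * v x + C \<le> k s"
proof -
  define m where "m = v x1 - G (x1 \<bullet> x1)"
  have m: "m > 0" using x1 by (simp add: m_def)
  define L where "L = B / 2"
  \<comment> \<open>Any \<open>K\<close> with \<open>L \<delta> - K \<delta>\<^sup>2 < m\<close> for all \<open>\<delta> \<ge> 0\<close> excludes maxima with \<open>x\<close> on the sphere.\<close>
  define K where "K = L\<^sup>2 / m + 1"
  have K: "K > 0" using m by (simp add: K_def add_nonneg_pos)
  define \<Phi> where "\<Phi> = (\<lambda>(x, s). v x - G s - K * (x \<bullet> x - s)\<^sup>2)"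
  have contG: "continuous_on {0..R\<^sup>2} G"
    using G by (meson DERIV_continuous continuous_on_eq_continuous_within)
  have "continuous_on (cball 0 R \<times> {0..R\<^sup>2}) \<Phi>"
    unfolding \<Phi>_def case_prod_unfold
    by (intro continuous_intros continuous_on_compose2[OF cont] continuous_on_compose2[OF contG]) auto
  moreover have "compact (cball (0::real^'n) R \<times> {0..R\<^sup>2})" by (intro compact_Times) auto
  moreover have x1': "(x1, x1 \<bullet> x1) \<in> cball 0 R \<times> {0..R\<^sup>2}"
    using x1 inner_self_le_square[of x1 R] by auto
  ultimately have "\<exists>w \<in> cball 0 R \<times> {0..R\<^sup>2}. \<forall>w' \<in> cball 0 R \<times> {0..R\<^sup>2}. \<Phi> w' \<le> \<Phi> w"
    by (intro continuous_attains_sup) blast+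
  then obtain w where w: "w \<in> cball 0 R \<times> {0..R\<^sup>2}" "\<forall>w' \<in> cball 0 R \<times> {0..R\<^sup>2}. \<Phi> w' \<le> \<Phi> w" ..
  obtain x s where "w = (x, s)" by (rule prod.exhaust)
  then have xs: "x \<in> cball 0 R" "s \<in> {0..R\<^sup>2}"
    and max: "\<And>y t. y \<in> cball 0 R \<Longrightarrow> t \<in> {0..R\<^sup>2} \<Longrightarrow> \<Phi> (y, t) \<le> \<Phi> (x, s)"
    using w by auto
  have \<Phi>m: "m \<le> \<Phi> (x, s)"
    using max[of x1 "x1 \<bullet> x1"] x1' by (simp add: \<Phi>_def m_def)
  define t where "t = 4 * K * (x \<bullet> x - s)"
  define \<psi> where "\<psi> = (\<lambda>\<sigma>. v x - G \<sigma> - K * (x \<bullet> x - \<sigma>)\<^sup>2)"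
  have \<psi>: "(\<psi> has_real_derivative (t - k s) / 2) (at s within {0..R\<^sup>2})"
    unfolding \<psi>_def t_def using xs(2)
    by (auto intro!: derivative_eq_intros G simp: algebra_simps)
  have \<psi>max: "\<psi> \<sigma> \<le> \<psi> s" if "\<sigma> \<in> {0..R\<^sup>2}" for \<sigma>
    using max[OF xs(1) that] by (simp add: \<Phi>_def \<psi>_def)
  have "norm x \<noteq> R"
  proof
    assume xR: "norm x = R"
    then have "v x = 0" "x \<bullet> x = R\<^sup>2"
      using bdry by (auto simp flip: power2_norm_eq_inner)
    define \<delta> where "\<delta> = R\<^sup>2 - s"
    have \<delta>: "\<delta> \<ge> 0" using xs by (simp add: \<delta>_def)
    have "- G s \<le> L * \<delta>"
    proof (cases "s = R\<^sup>2")
      case False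
      then have "s < R\<^sup>2" using xs by simp
      have "(G has_derivative (\<lambda>h. k r / 2 * h)) (at r within {s..R\<^sup>2})" if "s \<le> r" "r \<le> R\<^sup>2" for r
      proof -
        have "(G has_real_derivative k r / 2) (at r within {s..R\<^sup>2})"
          by (rule DERIV_subset[OF G]) (use that xs in auto)
        then show ?thesis unfolding has_field_derivative_def .
      qed
      from mvt_simple[OF \<open>s < R\<^sup>2\<close> this]
      have "\<exists>r\<in>{s<..<R\<^sup>2}. G (R\<^sup>2) - G s = k r / 2 * (R\<^sup>2 - s)" by blast
      then obtain r where r: "r \<in> {s<..<R\<^sup>2}" "- G s = k r / 2 * \<delta>"
        using GR by (auto simp: \<delta>_def)
      have "k r / 2 \<le> L" using k[of r] r(1) xs by (auto simp: L_def)
      then show ?thesis unfolding r(2) using \<delta> by (intro mult_right_mono) auto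
    qed (use GR in \<open>simp add: \<delta>_def\<close>)
    moreover have "m \<le> - G s - K * \<delta>\<^sup>2"
      using \<Phi>m \<open>v x = 0\<close> \<open>x \<bullet> x = R\<^sup>2\<close> by (simp add: \<Phi>_def \<delta>_def)
    ultimately have "m \<le> L * \<delta> - K * \<delta>\<^sup>2" by simp
    then have "m * m \<le> m * (L * \<delta> - K * \<delta>\<^sup>2)" using m by simp
    also have "\<dots> = m * (L * \<delta>) - (L * \<delta>)\<^sup>2 - m * \<delta>\<^sup>2"
      using m by (simp add: K_def field_simps power2_eq_square)
    finally have "m * m + (L * \<delta>)\<^sup>2 \<le> m * (L * \<delta>)" using m by (smt (verit) mult_nonneg_nonneg zero_le_power2)
    moreover have "0 \<le> (m - L * \<delta>)\<^sup>2" by simp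
    moreover have "(m - L * \<delta>)\<^sup>2 = m * m + (L * \<delta>)\<^sup>2 - 2 * (m * (L * \<delta>))"
      by (simp add: power2_eq_square algebra_simps)
    moreover have "m * m > 0" using m by simp
    moreover have "(L * \<delta>)\<^sup>2 \<ge> 0" by simp
    ultimately show False by linarith
  qed
  then have x: "x \<in> ball 0 R" using xs by auto
  then have "x \<bullet> x < R\<^sup>2"
    using power_strict_mono[of "norm x" R 2] by (simp flip: power2_norm_eq_inner)
  have "s \<noteq> R\<^sup>2"
  proof
    assume s: "s = R\<^sup>2"
    then have "t < 0" using K \<open>x \<bullet> x < R\<^sup>2\<close> by (simp add: t_def mult_less_0_iff)
    then have "(t - k s) / 2 < 0" using k[OF xs(2)] by simp
    from has_real_derivative_neg_dec_left[OF \<psi> this] obtain d where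
      d: "d > 0" "\<And>h. h > 0 \<Longrightarrow> s - h \<in> {0..R\<^sup>2} \<Longrightarrow> h < d \<Longrightarrow> \<psi> s < \<psi> (s - h)" by blast
    define h where "h = min (d / 2) (R\<^sup>2)"
    have "h > 0" "h < d" "s - h \<in> {0..R\<^sup>2}" using d \<open>0 < R\<close> s by (auto simp: h_def min_def)
    then show False using d(2)[of h] \<psi>max[of "s - h"] by simp
  qed
  then have s: "0 \<le> s" "s < R\<^sup>2" using xs by auto
  have t_le: "t \<le> k s"
  proof (rule ccontr)
    assume "\<not> t \<le> k s"
    then have "0 < (t - k s) / 2" by simp
    from has_real_derivative_pos_inc_right[OF \<psi> this] obtain d where
      d: "d > 0" "\<And>h. h > 0 \<Longrightarrow> s + h \<in> {0..R\<^sup>2} \<Longrightarrow> h < d \<Longrightarrow> \<psi> s < \<psi> (s + h)" by blast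
    define h where "h = min (d / 2) (R\<^sup>2 - s)"
    have "h > 0" "h < d" "s + h \<in> {0..R\<^sup>2}" using d s by (auto simp: h_def min_def)
    then show False using d(2)[of h] \<psi>max[of "s + h"] by simp
  qed
  \<comment> \<open>At \<open>s = 0\<close> only the inequality \<open>t \<le> k s\<close> survives, which suffices because then \<open>k s \<surd>s = 0\<close>.\<close>
  have t_eq: "t = k s" if "s > 0"
  proof (rule ccontr)
    assume "t \<noteq> k s"
    then have "(t - k s) / 2 < 0" using t_le by simp
    from has_real_derivative_neg_dec_left[OF \<psi> this] obtain d where
      d: "d > 0" "\<And>h. h > 0 \<Longrightarrow> s - h \<in> {0..R\<^sup>2} \<Longrightarrow> h < d \<Longrightarrow> \<psi> s < \<psi> (s - h)" by blast
    define h where "h = min (d / 2) s"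
    have "h > 0" "h < d" "s - h \<in> {0..R\<^sup>2}" using d s that by (auto simp: h_def min_def)
    then show False using d(2)[of h] \<psi>max[of "s - h"] by simp
  qed
  have test: "(\<bar>t\<bar> * norm x) powr p + \<gamma> * v x + C \<le> t"
    unfolding t_def
  proof (rule subsolution_quartic_test[OF sub i x])
    fix y :: "real^'n" assume "y \<in> ball 0 R"
    then show "v y - K * (y \<bullet> y - s)\<^sup>2 \<le> v x - K * (x \<bullet> x - s)\<^sup>2"
      using max[of y s] xs(2) by (simp add: \<Phi>_def)
  qed
  have "(k s * sqrt s) powr p \<le> (\<bar>t\<bar> * norm x) powr p"
  proof (cases "s = 0")
    case False
    then have "s > 0" using s by simp
    then have t: "t = k s" "t \<ge> 0" using t_eq k[OF xs(2)] by auto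
    have "s \<le> x \<bullet> x" using t(2) K by (simp add: t_def zero_le_mult_iff)
    then have "sqrt s \<le> norm x" by (simp add: norm_eq_sqrt_inner)
    then show ?thesis using t s p by (intro powr_mono2 mult_mono) auto
  qed simp
  then have "(k s * sqrt s) powr p + \<gamma> * v x + C \<le> k s" using test t_le by simp
  moreover have "0 \<le> K * (x \<bullet> x - s)\<^sup>2" using K by simp
  then have "G s < v x" using \<Phi>m m by (simp add: \<Phi>_def)
  ultimately show ?thesis using that x s by blast
qed

text \<open>
By compactness a closed superlevel set that misses the sphere stays away from it.
\<close>

lemma superlevel_away_from_sphere:
  fixes w :: "'a::euclidean_space \<Rightarrow> real"
  assumes cont: "continuous_on (cball 0 R) w" and bdry: "\<And>x. x \<in> sphere 0 R \<Longrightarrow> w x < c" and "0 < R"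
  obtains r where "0 < r" "r < R" "\<And>x. x \<in> cball 0 R \<Longrightarrow> c \<le> w x \<Longrightarrow> norm x \<le> r"
proof -
  define K where "K = cball 0 R \<inter> w -` {c..}"
  have "closed K" unfolding K_def by (rule continuous_closed_preimage[OF cont]) auto
  moreover have "bounded K" unfolding K_def by (rule bounded_subset[OF bounded_cball]) auto
  ultimately have K: "compact K" by (simp add: compact_eq_bounded_closed)
  show ?thesis
  proof (cases "K = {}")
    case True
    then have "norm x \<le> R / 2" if "x \<in> cball 0 R" "c \<le> w x" for x
      using that unfolding K_def by blast
    then show ?thesis using that[of "R / 2"] \<open>0 < R\<close> by simp
  next
    case False
    then obtain x where x: "x \<in> K" "\<forall>y\<in>K. norm y \<le> norm x"
      using continuous_attains_sup[OF K False, of norm] by (auto intro: continuous_intros)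
    have "norm x \<noteq> R" using x(1) bdry[of x] by (auto simp: K_def)
    then have "norm x < R" using x(1) by (auto simp: K_def)
    moreover have "norm y \<le> norm x" if "y \<in> cball 0 R" "c \<le> w y" for y
      using that x(2) by (auto simp: K_def)
    ultimately show ?thesis using that[of "max (norm x) (R / 2)"] \<open>0 < R\<close> by fastforce
  qed
qed

lemma continuous_on_imp_usc_on:
  assumes "continuous_on S u" shows "usc_on S u"
  unfolding usc_on_def
proof (intro ballI allI impI)
  fix x a assume "x \<in> S" "a > u x"
  then have "(u \<longlongrightarrow> u x) (at x within S)" using assms by (simp add: continuous_on_def)
  then show "\<forall>\<^sub>F y in at x within S. u y < a" using \<open>a > u x\<close> by (rule order_tendstoD)
qed

lemma continuous_on_imp_lsc_on:
  assumes "continuous_on S u" shows "lsc_on S u"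
  unfolding lsc_on_def
proof (intro ballI allI impI)
  fix x a assume "x \<in> S" "a < u x"
  then have "(u \<longlongrightarrow> u x) (at x within S)" using assms by (simp add: continuous_on_def)
  then show "\<forall>\<^sub>F y in at x within S. a < u y" using \<open>a < u x\<close> by (rule order_tendstoD)
qed

section \<open>Radial solutions and comparison with them\<close>

text \<open>
The data of \<open>radial_profile_exists\<close>.  The constant \<open>b\<close> is the critical double root and a bound
for the slope \<open>q\<close>.
\<close>

locale radial_profile =
  fixes p C R \<gamma> b :: real and H q :: "real \<Rightarrow> real"
  assumes p: "1 < p" and C: "0 < C" and R: "0 < R" and \<gamma>: "0 \<le> \<gamma>"
    and b_def: "b = p * C / (p - 1)" and crit: "(R * b) powr p \<le> C / (p - 1)"
    and H_R: "H (R\<^sup>2) = 0"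
    and H_deriv: "\<And>s. s \<in> {0..R\<^sup>2} \<Longrightarrow> (H has_real_derivative q s / 2) (at s within {0..R\<^sup>2})"
    and q_bounds: "\<And>s. s \<in> {0..R\<^sup>2} \<Longrightarrow> 0 \<le> q s \<and> q s \<le> b"
    and q_eq: "\<And>s. s \<in> {0..R\<^sup>2} \<Longrightarrow> q s = (q s * sqrt s) powr p + \<gamma> * H s + C"
    and q_mono: "\<And>s t. 0 \<le> s \<Longrightarrow> s \<le> t \<Longrightarrow> t \<le> R\<^sup>2 \<Longrightarrow> q s \<le> q t"
begin

lemma b_pos: "b > 0" using p C by (simp add: b_def)

text \<open>
Convexity of \<open>H\<close>.  For the radial function this is a paraboloid of opening \<open>q\<close> that touches it
from below along a whole sphere and stays below it on the entire ball.
\<close>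

lemma H_tangent:
  assumes s: "s \<in> {0..R\<^sup>2}" and t: "t \<in> {0..R\<^sup>2}"
  shows "q s / 2 * (t - s) \<le> H t - H s"
proof -
  have mvt: "\<exists>r\<in>{x<..<y}. H y - H x = q r / 2 * (y - x)" if "0 \<le> x" "x < y" "y \<le> R\<^sup>2" for x y
  proof -
    have "(H has_derivative (\<lambda>h. q r / 2 * h)) (at r within {x..y})" if "x \<le> r" "r \<le> y" for r
    proof -
      have "(H has_real_derivative q r / 2) (at r within {x..y})"
        by (rule DERIV_subset[OF H_deriv]) (use that \<open>0 \<le> x\<close> \<open>y \<le> R\<^sup>2\<close> in auto)
      then show ?thesis unfolding has_field_derivative_def .
    qed
    from mvt_simple[OF \<open>x < y\<close> this] show ?thesis by blast
  qed
  show ?thesis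
  proof (cases s t rule: linorder_cases)
    case less
    then obtain r where r: "r \<in> {s<..<t}" "H t - H s = q r / 2 * (t - s)"
      using mvt[of s t] s t by auto
    have "q s \<le> q r" using r(1) s t by (intro q_mono) auto
    then show ?thesis unfolding r(2) using less by (intro mult_right_mono) auto
  next
    case greater
    then obtain r where r: "r \<in> {t<..<s}" "H s - H t = q r / 2 * (s - t)"
      using mvt[of t s] s t by auto
    have "q r \<le> q s" using r(1) s t by (intro q_mono) auto
    then have "q r / 2 * (s - t) \<le> q s / 2 * (s - t)" using greater by (intro mult_right_mono) auto
    then have "H s - H t \<le> q s / 2 * (s - t)" unfolding r(2) .
    moreover have "q s / 2 * (t - s) = - (q s / 2 * (s - t))" by (simp only: right_diff_distrib)
    ultimately show ?thesis by linarith
  qed simp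
qed

lemma continuous_on_H: "continuous_on {0..R\<^sup>2} H"
  using H_deriv by (meson DERIV_continuous continuous_on_eq_continuous_within)

lemma continuous_on_radial: "continuous_on (cball (0::real^'n) R) (\<lambda>x. H (x \<bullet> x))"
  by (rule continuous_on_compose2[OF continuous_on_H])
     (use inner_self_le_square in \<open>auto intro!: continuous_intros\<close>)

text \<open>
The radial solution has \<open>|Du| = q \<surd>s \<le> b r\<close> on the ball of radius \<open>r\<close>, so inside the big ball the
critical value \<open>C / (p - 1)\<close> of \<open>|Du|\<^sup>p\<close> is not attained, even if \<open>R\<close> is critical.
\<close>

lemma gradient_subcritical:
  assumes "0 \<le> s" "s \<le> r\<^sup>2" "0 \<le> r" "r < R"
  shows "(q s * sqrt s) powr p \<le> (r * b) powr p" "(r * b) powr p < C / (p - 1)"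
proof -
  have "r\<^sup>2 \<le> R\<^sup>2" using assms by (intro power_mono) auto
  with \<open>s \<le> r\<^sup>2\<close> have "s \<le> R\<^sup>2" by (rule order_trans)
  then have s: "s \<in> {0..R\<^sup>2}" using assms by auto
  have "sqrt s \<le> r" using assms by (intro real_le_lsqrt) auto
  then have "q s * sqrt s \<le> b * r"
    using q_bounds[OF s] assms by (intro mult_mono) auto
  then show "(q s * sqrt s) powr p \<le> (r * b) powr p"
    using q_bounds[OF s] assms p by (intro powr_mono2) (auto simp: mult.commute)
  have "(r * b) powr p < (R * b) powr p"
    using assms b_pos p by (intro powr_less_mono2) auto
  then show "(r * b) powr p < C / (p - 1)" using crit by simp
qed

lemma q_norm_eq:
  fixes x :: "real^'n"
  assumes "norm x \<le> R"
  shows "q (x \<bullet> x) = (q (x \<bullet> x) * norm x) powr p + \<gamma> * H (x \<bullet> x) + C"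
  using q_eq[OF inner_self_le_square[OF assms]] by (simp add: norm_eq_sqrt_inner)

lemma radial_visc_subsolution:
  assumes i: "1 \<le> i" "i < CARD('n)"
  shows "visc_subsolution i p \<gamma> (\<lambda>_. - C) (ball 0 R) (\<lambda>x::real^'n. H (x \<bullet> x))"
  unfolding visc_subsolution_def
proof (intro conjI allI impI)
  have cont: "continuous_on (ball (0::real^'n) R) (\<lambda>x. H (x \<bullet> x))"
    by (rule continuous_on_subset[OF continuous_on_radial]) auto
  then show "usc_on (ball 0 R) (\<lambda>x::real^'n. H (x \<bullet> x))"
    by (rule continuous_on_imp_usc_on)
  fix \<phi> :: "real^'n \<Rightarrow> real" and x :: "real^'n"
  assume A: "C2_on (ball 0 R) \<phi> \<and> local_max_on (ball 0 R) (\<lambda>y. H (y \<bullet> y) - \<phi> y) x"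
  then have C2: "C2_on (ball 0 R) \<phi>" and x: "x \<in> ball 0 R"
    and "\<forall>\<^sub>F y in at x within ball 0 R. H (y \<bullet> y) - \<phi> y \<le> H (x \<bullet> x) - \<phi> x"
    unfolding local_max_on_def by blast+
  then have ev: "\<forall>\<^sub>F y in at x. H (y \<bullet> y) - \<phi> y \<le> H (x \<bullet> x) - \<phi> x"
    by (simp only: at_within_open[OF x open_ball])
  have xx: "x \<bullet> x \<in> {0..R\<^sup>2}" using x by (intro inner_self_le_square) auto
  have "\<forall>\<^sub>F y in at x. y \<in> ball 0 R"
    using x open_ball by (intro eventually_at_in_open') auto
  with ev have touch: "\<forall>\<^sub>F y in at x. q (x \<bullet> x) / 2 * (y \<bullet> y - x \<bullet> x) \<le> \<phi> y - \<phi> x"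
  proof eventually_elim
    case (elim y)
    then have "y \<bullet> y \<in> {0..R\<^sup>2}" by (intro inner_self_le_square) auto
    from H_tangent[OF xx this] elim(1) show ?case by linarith
  qed
  have "gradient \<phi> x = q (x \<bullet> x) *\<^sub>R x" "q (x \<bullet> x) \<le> eigval i (hessian \<phi> x)"
    using eigval_hessian_ge_of_paraboloid_below[OF C2 open_ball x i(1) _ touch] i(2) by auto
  then show "- eigval i (hessian \<phi> x) + norm (gradient \<phi> x) powr p + \<gamma> * H (x \<bullet> x) \<le> - C"
    using q_norm_eq[of x] x q_bounds[OF xx] by simp
qed

lemma radial_visc_supersolution:
  assumes i: "1 \<le> i" "i < CARD('n)"
  shows "visc_supersolution i p \<gamma> (\<lambda>_. - C) (ball 0 R) (\<lambda>x::real^'n. H (x \<bullet> x))"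
  unfolding visc_supersolution_def
proof (intro conjI allI impI)
  have cont: "continuous_on (ball (0::real^'n) R) (\<lambda>x. H (x \<bullet> x))"
    by (rule continuous_on_subset[OF continuous_on_radial]) auto
  then show "lsc_on (ball 0 R) (\<lambda>x::real^'n. H (x \<bullet> x))"
    by (rule continuous_on_imp_lsc_on)
  fix \<phi> :: "real^'n \<Rightarrow> real" and x :: "real^'n"
  assume A: "C2_on (ball 0 R) \<phi> \<and> local_min_on (ball 0 R) (\<lambda>y. H (y \<bullet> y) - \<phi> y) x"
  then have C2: "C2_on (ball 0 R) \<phi>" and x: "x \<in> ball 0 R"
    and "\<forall>\<^sub>F y in at x within ball 0 R. H (x \<bullet> x) - \<phi> x \<le> H (y \<bullet> y) - \<phi> y"
    unfolding local_min_on_def by blast+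
  then have ev: "\<forall>\<^sub>F y in at x. H (x \<bullet> x) - \<phi> x \<le> H (y \<bullet> y) - \<phi> y"
    by (simp only: at_within_open[OF x open_ball])
  have xx: "x \<bullet> x \<in> {0..R\<^sup>2}" using x by (intro inner_self_le_square) auto
  have touch: "\<forall>\<^sub>F y in at x. \<phi> y - \<phi> x \<le> H (y \<bullet> y) - H (x \<bullet> x)"
    using ev by eventually_elim simp
  have "gradient \<phi> x = q (x \<bullet> x) *\<^sub>R x" "eigval i (hessian \<phi> x) \<le> q (x \<bullet> x)"
    using eigval_hessian_le_of_radial_above[OF C2 x i H_deriv[OF xx] touch] by auto
  then show "- C \<le> - eigval i (hessian \<phi> x) + norm (gradient \<phi> x) powr p + \<gamma> * H (x \<bullet> x)"
    using q_norm_eq[of x] x q_bounds[OF xx] by simp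
qed

lemma radial_solves_DP:
  assumes i: "1 \<le> i" "i < CARD('n)"
  shows "solves_DP i p C R \<gamma> (\<lambda>x::real^'n. H (x \<bullet> x))"
  unfolding solves_DP_def visc_solution_def
proof (intro conjI ballI)
  show "continuous_on (cball 0 R) (\<lambda>x::real^'n. H (x \<bullet> x))" by (rule continuous_on_radial)
  then show "continuous_on (ball 0 R) (\<lambda>x::real^'n. H (x \<bullet> x))"
    by (rule continuous_on_subset) auto
  fix x :: "real^'n" assume "x \<in> sphere 0 R"
  then have "x \<bullet> x = R\<^sup>2" by (simp flip: power2_norm_eq_inner)
  then show "H (x \<bullet> x) = 0" by (simp add: H_R)
qed (use i radial_visc_subsolution radial_visc_supersolution in auto)

text \<open>
For \<open>\<gamma> = 0\<close> the competitor is \<open>\<kappa> u\<close> with \<open>\<kappa> < 1\<close> close to \<open>1\<close>.  With \<open>S = |Du|\<^sup>p\<close> it is a strict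
supersolution because \<open>\<kappa>\<^sup>p S + C - \<kappa> (S + C) \<ge> (1 - \<kappa>) (C - (p - 1) S) > 0\<close> by Bernoulli's
inequality.
\<close>

lemma solution_le_radial:
  fixes v :: "real^'n \<Rightarrow> real"
  assumes i: "1 \<le> i" "i < CARD('n)" and v: "solves_DP i p C R \<gamma> v" and x: "x \<in> cball 0 R"
  shows "v x \<le> H (x \<bullet> x)"
proof (rule ccontr)
  assume "\<not> ?thesis"
  then have gt: "H (x \<bullet> x) < v x" by simp
  have vsub: "visc_subsolution i p \<gamma> (\<lambda>_. - C) (ball 0 R) v" and cont: "continuous_on (cball 0 R) v"
    and bdry: "\<And>x. x \<in> sphere 0 R \<Longrightarrow> v x = 0"
    using v by (auto simp: solves_DP_def visc_solution_def)
  obtain \<kappa> where \<kappa>: "0 < \<kappa>" "\<kappa> \<le> 1" "\<kappa> * H (x \<bullet> x) < v x" and strict: "\<gamma> = 0 \<Longrightarrow> \<kappa> < 1" "\<gamma> \<noteq> 0 \<Longrightarrow> \<kappa> = 1"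
  proof (cases "\<gamma> = 0")
    case True
    have "((\<lambda>\<kappa>. \<kappa> * H (x \<bullet> x)) \<longlongrightarrow> 1 * H (x \<bullet> x)) (at_left 1)"
      by (intro tendsto_intros)
    then have "\<forall>\<^sub>F \<kappa> in at_left 1. \<kappa> * H (x \<bullet> x) < v x"
      using gt by (intro order_tendstoD) auto
    moreover have "\<forall>\<^sub>F \<kappa> in at_left (1::real). \<kappa> \<in> {0<..<1}"
      by (rule eventually_at_left_real) simp
    ultimately have "\<forall>\<^sub>F \<kappa> in at_left 1. \<kappa> * H (x \<bullet> x) < v x \<and> \<kappa> \<in> {0<..<1}"
      by (rule eventually_conj)
    then obtain \<kappa> where "\<kappa> * H (x \<bullet> x) < v x" "\<kappa> \<in> {0<..<1}"
      using eventually_happens' trivial_limit_at_left_real by blast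
    then show ?thesis using that[of \<kappa>] True by auto
  next
    case False
    then show ?thesis using that[of 1] gt by simp
  qed
  obtain y s where y: "0 \<le> s" "s < R\<^sup>2" "\<kappa> * H s < v y"
    "(\<kappa> * q s * sqrt s) powr p + \<gamma> * v y + C \<le> \<kappa> * q s"
  proof (rule subsolution_doubling[OF vsub i _ R cont bdry, where G="\<lambda>s. \<kappa> * H s" and k="\<lambda>s. \<kappa> * q s" and B=b])
    show "0 \<le> p" using p by simp
    show "\<kappa> * H (R\<^sup>2) = 0" by (simp add: H_R)
    show "((\<lambda>s. \<kappa> * H s) has_real_derivative \<kappa> * q s / 2) (at s within {0..R\<^sup>2})" if "s \<in> {0..R\<^sup>2}" for s
      using DERIV_cmult[OF H_deriv[OF that], of \<kappa>] by simp
    show "0 \<le> \<kappa> * q s \<and> \<kappa> * q s \<le> b" if "s \<in> {0..R\<^sup>2}" for s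
      using q_bounds[OF that] \<kappa>(1,2) mult_left_le_one_le[of "q s" \<kappa>] by auto
    show "\<kappa> * H (x \<bullet> x) < v x" by (rule \<kappa>(3))
  qed (use x in auto)
  have s: "s \<in> {0..R\<^sup>2}" using y by auto
  show False
  proof (cases "\<gamma> = 0")
    case False
    then have "\<gamma> * H s < \<gamma> * v y" using y(3) strict(2) \<gamma> by simp
    then show False using y(4) q_eq[OF s] strict(2)[OF False] by simp
  next
    case True
    define S where "S = (q s * sqrt s) powr p"
    have "sqrt s < R" using y R by (intro real_less_lsqrt) auto
    then have "S < C / (p - 1)"
      using gradient_subcritical[of s "sqrt s"] y by (simp add: S_def)
    then have S: "S * (p - 1) < C" using p by (simp add: pos_less_divide_eq)
    have "(\<kappa> * q s * sqrt s) powr p = \<kappa> powr p * S"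
      using \<kappa>(1) y(1) q_bounds[OF s] by (simp add: S_def powr_mult mult.assoc)
    moreover have "q s = S + C" using q_eq[OF s] True by (simp add: S_def)
    ultimately have "\<kappa> powr p * S + C \<le> \<kappa> * (S + C)" using y(4) True by simp
    moreover have "(1 + p * (\<kappa> - 1)) * S \<le> \<kappa> powr p * S"
      using powr_ge_tangent_at_1[of \<kappa> p] \<kappa>(1) p by (intro mult_right_mono) (auto simp: S_def)
    ultimately have "(1 - \<kappa>) * C \<le> (1 - \<kappa>) * (S * (p - 1))" by (simp add: algebra_simps)
    then show False using S strict(1)[OF True] by simp
  qed
qed

text \<open>
Where \<open>v - \<kappa> u\<close> is minimal, the paraboloid below \<open>\<kappa> u\<close> touches \<open>v\<close> from below as well and can serve
as the test function.
\<close>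

lemma supersolution_touching_scaled_radial:
  fixes v :: "real^'n \<Rightarrow> real"
  assumes i: "1 \<le> i" "i < CARD('n)" and super: "visc_supersolution i p \<gamma> (\<lambda>_. - C) (ball 0 R) v"
    and \<kappa>: "0 \<le> \<kappa>" and x: "x \<in> ball 0 R"
    and min: "\<And>y. y \<in> ball 0 R \<Longrightarrow> v x - \<kappa> * H (x \<bullet> x) \<le> v y - \<kappa> * H (y \<bullet> y)"
  shows "\<kappa> * q (x \<bullet> x) \<le> \<kappa> powr p * (q (x \<bullet> x) * norm x) powr p + \<gamma> * v x + C"
proof -
  have xx: "x \<bullet> x \<in> {0..R\<^sup>2}" using x by (intro inner_self_le_square) auto
  let ?c = "\<kappa> * q (x \<bullet> x)"
  have "?c \<le> (\<bar>?c\<bar> * norm x) powr p + \<gamma> * v x + C"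
  proof (rule supersolution_quadratic_test[OF super i(1) _ x])
    fix y :: "real^'n" assume y: "y \<in> ball 0 R"
    then have "y \<bullet> y \<in> {0..R\<^sup>2}" by (intro inner_self_le_square) auto
    from mult_left_mono[OF H_tangent[OF xx this] \<kappa>]
    have "?c / 2 * (y \<bullet> y - x \<bullet> x) \<le> \<kappa> * H (y \<bullet> y) - \<kappa> * H (x \<bullet> x)"
      by (simp add: algebra_simps)
    then show "v x - ?c / 2 * (x \<bullet> x) \<le> v y - ?c / 2 * (y \<bullet> y)"
      using min[OF y] right_diff_distrib[of "?c / 2" "y \<bullet> y" "x \<bullet> x"] by linarith
  qed (use i in simp)
  moreover have "(\<bar>?c\<bar> * norm x) powr p = \<kappa> powr p * (q (x \<bullet> x) * norm x) powr p"
    using \<kappa> q_bounds[OF xx] by (simp add: powr_mult mult.assoc)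
  ultimately show ?thesis by simp
qed

text \<open>
For \<open>\<gamma> = 0\<close> the competitor is \<open>\<kappa> u\<close> with \<open>\<kappa> > 1\<close>.  It is a strict subsolution where
\<open>(\<kappa>\<^sup>p - \<kappa>) |Du|\<^sup>p < (\<kappa> - 1) C\<close>; near \<open>\<kappa> = 1\<close> this holds as soon as \<open>|Du|\<^sup>p\<close> is bounded away from
\<open>C / (p - 1)\<close>.  In the critical case that fails at the sphere, so contact points are first confined
to a smaller ball of radius \<open>r\<close>, outside of which \<open>u - v\<close> is small.
\<close>

lemma radial_le_solution:
  fixes v :: "real^'n \<Rightarrow> real"
  assumes i: "1 \<le> i" "i < CARD('n)" and v: "solves_DP i p C R \<gamma> v" and x: "x \<in> cball 0 R"
  shows "H (x \<bullet> x) \<le> v x"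
proof (rule ccontr)
  assume "\<not> ?thesis"
  then have lt: "v x < H (x \<bullet> x)" by simp
  have super: "visc_supersolution i p \<gamma> (\<lambda>_. - C) (ball 0 R) v" and cont: "continuous_on (cball 0 R) v"
    and bdry: "\<And>x. x \<in> sphere 0 R \<Longrightarrow> v x = 0"
    using v by (auto simp: solves_DP_def visc_solution_def)
  define u where "u = (\<lambda>y::real^'n. H (y \<bullet> y))"
  have contu: "continuous_on (cball 0 R) u" unfolding u_def by (rule continuous_on_radial)
  have u0: "u y = 0" if "y \<in> sphere 0 R" for y
  proof -
    have "y \<bullet> y = R\<^sup>2" using that by (simp flip: power2_norm_eq_inner)
    then show ?thesis by (simp add: u_def H_R)
  qed
  define m where "m = u x - v x"
  have m: "m > 0" using lt by (simp add: m_def u_def)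
  have exmin: "\<exists>z \<in> cball 0 R. \<forall>y \<in> cball 0 R. v z - \<kappa> * u z \<le> v y - \<kappa> * u y" for \<kappa>
    using R by (intro continuous_attains_inf continuous_intros cont contu) auto
  obtain r where r: "0 < r" "r < R" "\<And>y. y \<in> cball 0 R \<Longrightarrow> m / 2 \<le> u y - v y \<Longrightarrow> norm y \<le> r"
  proof (rule superlevel_away_from_sphere[where w="\<lambda>y. u y - v y" and c="m / 2" and R=R])
    show "continuous_on (cball 0 R) (\<lambda>y. u y - v y)" by (intro continuous_intros cont contu)
    show "u y - v y < m / 2" if "y \<in> sphere 0 R" for y using that m by (simp add: u0 bdry)
  qed (use R in auto)
  have "bounded (u ` cball 0 R)"
    by (intro compact_imp_bounded compact_continuous_image contu) auto
  then obtain M where "\<forall>z \<in> u ` cball 0 R. \<bar>z\<bar> \<le> M" unfolding bounded_real ..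
  then have M: "\<And>y. y \<in> cball 0 R \<Longrightarrow> \<bar>u y\<bar> \<le> M" by blast
  have M0: "0 \<le> M" using M[OF x] by linarith
  define S where "S = (r * b) powr p"
  have S: "S < C / (p - 1)" using gradient_subcritical(2)[of 0 r] r by (simp add: S_def)
  have "\<exists>\<kappa>. 1 \<le> \<kappa> \<and> (\<kappa> - 1) * (2 * M) \<le> m / 2 \<and> (\<gamma> = 0 \<longrightarrow> (\<kappa> powr p - \<kappa>) * S < (\<kappa> - 1) * C) \<and> (\<gamma> \<noteq> 0 \<longrightarrow> \<kappa> = 1)"
  proof (cases "\<gamma> = 0")
    case False
    then show ?thesis using m by (intro exI[of _ 1]) simp
  next
    case True
    \<comment> \<open>The expression vanishes at \<open>\<kappa> = 1\<close> and decreases there.\<close>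
    have "((\<lambda>\<kappa>. (\<kappa> powr p - \<kappa>) * S - (\<kappa> - 1) * C) has_real_derivative (p - 1) * S - C) (at 1)"
      by (auto intro!: derivative_eq_intros)
    moreover have "(p - 1) * S - C < 0" using S p by (simp add: pos_less_divide_eq mult.commute)
    ultimately obtain d where d: "d > 0"
      "\<And>h. h > 0 \<Longrightarrow> h < d \<Longrightarrow> ((1 + h) powr p - (1 + h)) * S - ((1 + h) - 1) * C < (1 powr p - 1) * S - (1 - 1) * C"
      using DERIV_neg_dec_right by blast
    define h where "h = min (d / 2) (m / (4 * (M + 1)))"
    have "h \<le> d / 2" unfolding h_def by (rule min.cobounded1)
    moreover have "m / (4 * (M + 1)) > 0" using m M0 by simp
    ultimately have h: "h > 0" "h < d" using d(1) by (auto simp: h_def)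
    have "h * (2 * M) \<le> m / (4 * (M + 1)) * (2 * M)"
      using M0 by (intro mult_right_mono) (auto simp: h_def)
    also have "\<dots> \<le> m / 2" using M0 m by (simp add: field_simps)
    finally show ?thesis using d(2)[OF h] h(1) True by (intro exI[of _ "1 + h"]) simp
  qed
  then obtain \<kappa> where \<kappa>: "1 \<le> \<kappa>" "(\<kappa> - 1) * (2 * M) \<le> m / 2"
    "\<gamma> = 0 \<Longrightarrow> (\<kappa> powr p - \<kappa>) * S < (\<kappa> - 1) * C" "\<gamma> \<noteq> 0 \<Longrightarrow> \<kappa> = 1" by blast
  obtain z where z: "z \<in> cball 0 R" "\<And>y. y \<in> cball 0 R \<Longrightarrow> v z - \<kappa> * u z \<le> v y - \<kappa> * u y"
    using exmin[of \<kappa>] by blast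
  have "(\<kappa> - 1) * (u z - u x) \<le> (\<kappa> - 1) * (2 * M)"
    using M[OF x] M[OF z(1)] \<kappa>(1) by (intro mult_left_mono) auto
  then have "(\<kappa> - 1) * (u z - u x) \<le> m / 2" using \<kappa>(2) by simp
  moreover have "v z - \<kappa> * u z \<le> v x - \<kappa> * u x" by (rule z(2)[OF x])
  ultimately have uvz: "m / 2 \<le> u z - v z" by (simp add: m_def field_simps)
  then have zr: "norm z \<le> r" using r(3)[OF z(1)] by simp
  then have zball: "z \<in> ball 0 R" using r by simp
  have zz: "z \<bullet> z \<in> {0..R\<^sup>2}" using z(1) by (intro inner_self_le_square) simp
  have main: "\<kappa> * q (z \<bullet> z) \<le> \<kappa> powr p * (q (z \<bullet> z) * norm z) powr p + \<gamma> * v z + C"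
    using z(2) \<kappa>(1) by (intro supersolution_touching_scaled_radial[OF i super _ zball]) (auto simp: u_def)
  have eq: "q (z \<bullet> z) = (q (z \<bullet> z) * norm z) powr p + \<gamma> * u z + C"
    using q_norm_eq[of z] z(1) by (simp add: u_def)
  show False
  proof (cases "\<gamma> = 0")
    case False
    then have "\<gamma> * v z < \<gamma> * u z" using uvz m \<gamma> by simp
    then show False using main eq \<kappa>(4)[OF False] by simp
  next
    case True
    let ?s = "(q (z \<bullet> z) * norm z) powr p"
    have "z \<bullet> z \<le> r\<^sup>2" using inner_self_le_square[OF zr] by simp
    from gradient_subcritical(1)[OF _ this] have "?s \<le> S"
      using r by (simp add: S_def norm_eq_sqrt_inner)
    have "\<kappa> powr 1 \<le> \<kappa> powr p" using \<kappa>(1) p by (intro powr_mono) auto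
    then have "(\<kappa> powr p - \<kappa>) * ?s \<le> (\<kappa> powr p - \<kappa>) * S"
      using \<kappa>(1) \<open>?s \<le> S\<close> by (intro mult_left_mono) auto
    moreover have "\<kappa> * (?s + C) \<le> \<kappa> powr p * ?s + C" using main eq True by simp
    ultimately show False using \<kappa>(3)[OF True] by (simp add: algebra_simps)
  qed
qed

end

section \<open>The critical radius\<close>

text \<open>
At the critical radius \<open>a0\<close> the line \<open>t - C\<close> is tangent to \<open>(a0 t)\<^sup>p\<close> at \<open>t = b\<close>.  A larger radius \<open>a\<close>
amounts to the rescaling \<open>(a t)\<^sup>p = (a0 l t)\<^sup>p / l\<close> with \<open>l = (a / a0)\<^bsup>p / (p - 1)\<^esup> > 1\<close>, which turns \<open>C\<close> into
\<open>C / l\<close> and leaves the gap \<open>\<epsilon> = C - C / l\<close>.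
\<close>

lemma supercritical_gap:
  fixes p C R b :: real
  assumes p: "1 < p" and C: "0 < C" and b_def: "b = p * C / (p - 1)" and "0 < R"
    and R: "C / (p - 1) < (R * b) powr p"
  obtains a \<epsilon> where "0 < a" "a < R" "0 < \<epsilon>" "\<epsilon> < C" "\<And>t. 0 \<le> t \<Longrightarrow> t + \<epsilon> \<le> (a * t) powr p + C"
proof -
  have b: "b > 0" using p C by (simp add: b_def)
  define S where "S = C / (p - 1)"
  have S: "S > 0" using p C by (simp add: S_def)
  define a0 where "a0 = S powr (1 / p) / b"
  have a0: "a0 > 0" using S b by (simp add: a0_def)
  have a0b: "(a0 * b) powr p = S" using S b p by (simp add: a0_def powr_powr)
  have "a0 < R"
  proof (rule ccontr)
    assume "\<not> a0 < R"
    then have "(R * b) powr p \<le> (a0 * b) powr p"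
      using \<open>0 < R\<close> b p by (intro powr_mono2 mult_right_mono) auto
    then show False using R a0b by (simp add: S_def)
  qed
  have tangent: "t - C \<le> (a0 * t) powr p" if "0 \<le> t" for t
  proof -
    have "a0 * t = (a0 * b) * (t / b)" using b by simp
    then have "(a0 * t) powr p = S * (t / b) powr p"
      using that a0 b a0b by (metis powr_mult)
    moreover have "S * (1 + p * (t / b - 1)) \<le> S * (t / b) powr p"
      using that b S p by (intro mult_left_mono powr_ge_tangent_at_1) auto
    moreover have "S * (1 + p * (t / b - 1)) = t - C"
    proof -
      have "S * p / b = 1" using p C by (simp add: S_def b_def)
      then have "S * (p * (t / b)) = t" by (metis (no_types, opaque_lifting) mult.assoc mult.commute mult_1 times_divide_eq_right)
      moreover have "S * (p - 1) = C" using p by (simp add: S_def)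
      ultimately show ?thesis by (simp add: algebra_simps)
    qed
    ultimately show ?thesis by simp
  qed
  obtain a where a: "a0 < a" "a < R" using \<open>a0 < R\<close> dense by blast
  define l where "l = (a / a0) powr (p / (p - 1))"
  have l: "l > 1" using a a0 p by (simp add: l_def)
  have lp: "l powr p * a0 powr p = l * a powr p"
  proof -
    have "l powr p = l * l powr (p - 1)" using l powr_add[of l 1 "p - 1"] by simp
    moreover have "l powr (p - 1) = (a / a0) powr p" using p by (simp add: l_def powr_powr)
    moreover have "(a / a0) powr p * a0 powr p = a powr p" using a a0 by (simp add: powr_divide)
    ultimately show ?thesis by (simp add: mult.assoc)
  qed
  have "t + (C - C / l) \<le> (a * t) powr p + C" if "0 \<le> t" for t
  proof -
    have "l * t - C \<le> (a0 * (l * t)) powr p" using that l by (intro tangent) auto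
    also have "\<dots> = l powr p * a0 powr p * t powr p"
      using that l a0 by (simp add: powr_mult mult_ac)
    also have "\<dots> = l * (a * t) powr p" unfolding lp using that a a0 by (simp add: powr_mult)
    finally have "t - C / l \<le> (a * t) powr p" using l by (simp add: field_simps)
    then show ?thesis by simp
  qed
  moreover have "0 < C - C / l" "C - C / l < C" using l C by (simp_all add: field_simps)
  ultimately show ?thesis using that[of a "C - C / l"] a a0 by auto
qed

text \<open>
The boundary condition makes \<open>\<gamma> v\<close> exceed \<open>- \<epsilon>\<close> in an annulus \<open>a' < |x| \<le> R\<close>.  A large multiple of
\<open>(|y|\<^sup>2 - \<beta>)\<^sup>2\<close>, with \<open>\<surd>\<beta>\<close> inside the annulus, pushes the maximum of the difference into the
annulus and away from the sphere, and there every slope \<open>t\<close> violates the inequality for subsolutions.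
\<close>

lemma no_subsolution_supercritical:
  fixes v :: "real^'n \<Rightarrow> real"
  assumes i: "1 \<le> i" "i < CARD('n)" and p: "1 < p" and C: "0 < C" and \<gamma>: "0 \<le> \<gamma>" and "0 < R"
    and b_def: "b = p * C / (p - 1)" and R: "C / (p - 1) < (R * b) powr p"
  shows "\<not> solves_DP i p C R \<gamma> v"
proof
  assume v: "solves_DP i p C R \<gamma> v"
  have vsub: "visc_subsolution i p \<gamma> (\<lambda>_. - C) (ball 0 R) v" and cont: "continuous_on (cball 0 R) v"
    and bdry: "\<And>x. x \<in> sphere 0 R \<Longrightarrow> v x = 0"
    using v by (auto simp: solves_DP_def visc_solution_def)
  obtain a \<epsilon> where a: "0 < a" "a < R" and \<epsilon>: "0 < \<epsilon>" "\<epsilon> < C"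
    and gap: "\<And>t. 0 \<le> t \<Longrightarrow> t + \<epsilon> \<le> (a * t) powr p + C"
    using supercritical_gap[OF p C b_def \<open>0 < R\<close> R] by metis
  obtain r where r: "0 < r" "r < R" "\<And>y. y \<in> cball 0 R \<Longrightarrow> \<epsilon> \<le> - \<gamma> * v y \<Longrightarrow> norm y \<le> r"
  proof (rule superlevel_away_from_sphere[where w="\<lambda>y. - \<gamma> * v y" and c=\<epsilon> and R=R])
    show "continuous_on (cball 0 R) (\<lambda>y. - \<gamma> * v y)" by (intro continuous_intros cont)
    show "- \<gamma> * v y < \<epsilon>" if "y \<in> sphere 0 R" for y using that \<epsilon> by (simp add: bdry)
  qed (use \<open>0 < R\<close> in auto)
  define a' where "a' = max a r"
  have a': "0 < a'" "a' < R" "a \<le> a'" "r \<le> a'" using a r by (auto simp: a'_def)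
  define c where "c = (a' + R) / 2"
  have c: "a' < c" "c < R" using a' by (auto simp: c_def)
  define \<beta> where "\<beta> = c\<^sup>2"
  have \<beta>: "a'\<^sup>2 < \<beta>" "\<beta> < R\<^sup>2" using c a' by (auto simp: \<beta>_def intro!: power_strict_mono)
  define D where "D = min ((R\<^sup>2 - \<beta>)\<^sup>2) ((\<beta> - a'\<^sup>2)\<^sup>2)"
  have D: "D > 0" using \<beta> by (simp add: D_def)
  have "bounded (v ` cball 0 R)"
    by (intro compact_imp_bounded compact_continuous_image cont) auto
  then obtain V where "\<forall>z \<in> v ` cball 0 R. \<bar>z\<bar> \<le> V" unfolding bounded_real ..
  then have V: "\<And>y. y \<in> cball 0 R \<Longrightarrow> \<bar>v y\<bar> \<le> V" by blast
  have V0: "0 \<le> V" using V[of 0] \<open>0 < R\<close> by simp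
  define K where "K = (2 * V + 1) / D"
  have K: "K > 0" "K * D = 2 * V + 1" using D V0 by (auto simp: K_def)
  define f where "f = (\<lambda>y. v y - K * (y \<bullet> y - \<beta>)\<^sup>2)"
  have "continuous_on (cball 0 R) f" unfolding f_def by (intro continuous_intros cont)
  then obtain x where x: "x \<in> cball 0 R" and max: "\<And>y. y \<in> cball 0 R \<Longrightarrow> f y \<le> f x"
    using continuous_attains_sup[of "cball 0 R" f] \<open>0 < R\<close> by auto
  obtain y0 :: "real^'n" where y0: "norm y0 = c" using vector_choose_size[of c] c a' by auto
  then have "y0 \<bullet> y0 = \<beta>" by (simp add: \<beta>_def flip: power2_norm_eq_inner)
  then have "- V \<le> f y0" using V[of y0] y0 c by (simp add: f_def)
  then have fx: "- V \<le> f x" using max[of y0] y0 c by simp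
  have far: "f x < - V" if "D \<le> (x \<bullet> x - \<beta>)\<^sup>2"
  proof -
    have "2 * V + 1 \<le> K * (x \<bullet> x - \<beta>)\<^sup>2" using mult_left_mono[OF that, of K] K by simp
    then show ?thesis using V[OF x] by (simp add: f_def)
  qed
  have "a' < norm x"
  proof (rule ccontr)
    assume "\<not> a' < norm x"
    then have "x \<bullet> x \<le> a'\<^sup>2" using inner_self_le_square[of x a'] by simp
    then have "(\<beta> - a'\<^sup>2)\<^sup>2 \<le> (\<beta> - x \<bullet> x)\<^sup>2" using \<beta> by (intro power_mono) auto
    then show False using far fx by (simp add: D_def power2_commute[of \<beta>] min_le_iff_disj)
  qed
  have "norm x \<noteq> R"
  proof
    assume "norm x = R"
    then have "x \<bullet> x = R\<^sup>2" by (simp flip: power2_norm_eq_inner)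
    then show False using far fx by (simp add: D_def)
  qed
  then have xb: "x \<in> ball 0 R" using x by simp
  define t where "t = 4 * K * (x \<bullet> x - \<beta>)"
  have test: "(\<bar>t\<bar> * norm x) powr p + \<gamma> * v x + C \<le> t"
    unfolding t_def
    using max by (intro subsolution_quartic_test[OF vsub i xb]) (auto simp: f_def)
  have "- \<gamma> * v x < \<epsilon>" using r(3)[OF x] \<open>a' < norm x\<close> a' by fastforce
  then have lt: "(\<bar>t\<bar> * norm x) powr p + C < t + \<epsilon>" using test by simp
  moreover have "0 \<le> (\<bar>t\<bar> * norm x) powr p" by simp
  ultimately have t: "0 \<le> t" using \<epsilon> by linarith
  have "a * t \<le> norm x * t" using t a' \<open>a' < norm x\<close> by (intro mult_right_mono) auto
  then have "(a * t) powr p \<le> (\<bar>t\<bar> * norm x) powr p"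
    using t a p by (intro powr_mono2) (auto simp: mult.commute)
  then show False using gap[OF t] lt by simp
qed

text \<open>
The critical radius \<open>Rb\<close> is the one with \<open>(Rb b)\<^sup>p = C / (p - 1)\<close>.
\<close>

lemma critical_radius_iff:
  fixes p C R :: real
  assumes p: "1 < p" and C: "0 < C" and "0 < R"
  shows "R \<le> (p - 1) powr ((p - 1) / p) / (p * C powr ((p - 1) / p)) \<longleftrightarrow>
    (R * (p * C / (p - 1))) powr p \<le> C / (p - 1)"
proof -
  define b where "b = p * C / (p - 1)"
  have b: "b > 0" using p C by (simp add: b_def)
  define Rb where "Rb = (p - 1) powr ((p - 1) / p) / (p * C powr ((p - 1) / p))"
  have Rb: "Rb > 0" using p C by (simp add: Rb_def)
  have e: "(p - 1) / p * p = p - 1" using p by simp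
  have "Rb * b = C / (p - 1) * ((p - 1) powr ((p - 1) / p) / C powr ((p - 1) / p))"
    using p by (simp add: Rb_def b_def mult.commute)
  also have "\<dots> = C / (p - 1) * ((p - 1) / C) powr ((p - 1) / p)"
    using p C by (simp add: powr_divide)
  finally have "Rb * b = C / (p - 1) * ((p - 1) / C) powr ((p - 1) / p)" .
  then have "(Rb * b) powr p = (C / (p - 1)) powr p * (((p - 1) / C) powr ((p - 1) / p)) powr p"
    by (simp only: powr_mult)
  also have "(((p - 1) / C) powr ((p - 1) / p)) powr p = ((p - 1) / C) powr (p - 1)"
    unfolding powr_powr e ..
  also have "((p - 1) / C) powr (p - 1) = inverse ((C / (p - 1)) powr (p - 1))"
    using p C by (metis inverse_divide inverse_powr divide_nonneg_nonneg less_imp_le diff_ge_0_iff_ge)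
  also have "(C / (p - 1)) powr p * inverse ((C / (p - 1)) powr (p - 1)) = C / (p - 1)"
    using p C by (simp add: divide_inverse[symmetric] powr_diff[symmetric])
  finally have crit: "(Rb * b) powr p = C / (p - 1)" .
  have "R \<le> Rb \<longleftrightarrow> (R * b) powr p \<le> (Rb * b) powr p"
  proof
    assume "R \<le> Rb"
    then show "(R * b) powr p \<le> (Rb * b) powr p"
      using \<open>0 < R\<close> b p by (intro powr_mono2 mult_right_mono) auto
  next
    assume *: "(R * b) powr p \<le> (Rb * b) powr p"
    show "R \<le> Rb"
    proof (rule ccontr)
      assume "\<not> R \<le> Rb"
      then have "(Rb * b) powr p < (R * b) powr p"
        using Rb b p by (intro powr_less_mono2) auto
      then show False using * by simp
    qed
  qed
  then show ?thesis unfolding crit by (simp add: Rb_def b_def)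
qed

section \<open>Existence and uniqueness\<close>

theorem proposition1p2:
  fixes i :: nat and p C R \<gamma> :: real
  assumes "CARD('n::finite) \<ge> 2"
    and "i \<in> {1..CARD('n) - 1}"
    and "p > 1" and "C > 0" and "R > 0" and "\<gamma> > 0"
  defines "Rbar \<equiv> (p - 1) powr ((p - 1) / p) / (p * C powr ((p - 1) / p))"
  shows "((\<exists>u :: real^'n \<Rightarrow> real. solves_DP i p C R 0 u) \<longleftrightarrow>
          (\<exists>u :: real^'n \<Rightarrow> real. solves_DP i p C R \<gamma> u)) \<and>
         (\<forall>u v :: real^'n \<Rightarrow> real. solves_DP i p C R 0 u \<and> solves_DP i p C R 0 v \<longrightarrow>
            (\<forall>x\<in>cball 0 R. u x = v x)) \<and>
         (\<forall>u v :: real^'n \<Rightarrow> real. solves_DP i p C R \<gamma> u \<and> solves_DP i p C R \<gamma> v \<longrightarrow>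
            (\<forall>x\<in>cball 0 R. u x = v x)) \<and>
         ((\<exists>u :: real^'n \<Rightarrow> real. solves_DP i p C R 0 u) \<longleftrightarrow> R \<le> Rbar) \<and>
         ((\<exists>u :: real^'n \<Rightarrow> real. solves_DP i p C R \<gamma> u) \<longleftrightarrow> R \<le> Rbar)"
proof -
  have i: "1 \<le> i" "i < CARD('n)" using assms(1,2) by auto
  define b where "b = p * C / (p - 1)"
  have Rbar: "R \<le> Rbar \<longleftrightarrow> (R * b) powr p \<le> C / (p - 1)"
    unfolding Rbar_def b_def using assms by (intro critical_radius_iff) auto
  have profile: "\<exists>H q. radial_profile p C R g b H q" if "R \<le> Rbar" "0 \<le> g" for g
  proof -
    have le: "(R * b) powr p \<le> C / (p - 1)" using that(1) Rbar by simp
    obtain H q :: "real \<Rightarrow> real" where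
      "H (R\<^sup>2) = 0"
      "\<And>s. s \<in> {0..R\<^sup>2} \<Longrightarrow> (H has_real_derivative q s / 2) (at s within {0..R\<^sup>2})"
      "\<And>s. s \<in> {0..R\<^sup>2} \<Longrightarrow> 0 \<le> q s \<and> q s \<le> b"
      "\<And>s. s \<in> {0..R\<^sup>2} \<Longrightarrow> q s = (q s * sqrt s) powr p + g * H s + C"
      "\<And>s t. 0 \<le> s \<Longrightarrow> s \<le> t \<Longrightarrow> t \<le> R\<^sup>2 \<Longrightarrow> q s \<le> q t"
      by (rule radial_profile_exists[OF \<open>p > 1\<close> \<open>C > 0\<close> \<open>R > 0\<close> \<open>0 \<le> g\<close> le[unfolded b_def], folded b_def]) blast
    then have "radial_profile p C R g b H q"
      using assms le that(2) by unfold_locales (auto simp: b_def)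
    then show ?thesis by blast
  qed
  have exists_iff: "(\<exists>u :: real^'n \<Rightarrow> real. solves_DP i p C R g u) \<longleftrightarrow> R \<le> Rbar" if g: "0 \<le> g" for g
  proof
    assume "\<exists>u :: real^'n \<Rightarrow> real. solves_DP i p C R g u"
    then show "R \<le> Rbar"
      using no_subsolution_supercritical[OF i \<open>p > 1\<close> \<open>C > 0\<close> g \<open>R > 0\<close> b_def] Rbar by force
  next
    assume "R \<le> Rbar"
    then obtain H q where "radial_profile p C R g b H q" using profile g by blast
    then show "\<exists>u :: real^'n \<Rightarrow> real. solves_DP i p C R g u"
      using radial_profile.radial_solves_DP i by blast
  qed
  have unique: "u x = v x" if g: "0 \<le> g" and uv: "solves_DP i p C R g u" "solves_DP i p C R g v" and x: "x \<in> cball 0 R"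
    for g and u v :: "real^'n \<Rightarrow> real" and x
  proof -
    have "R \<le> Rbar" using exists_iff[OF g] uv by blast
    then obtain H q where "radial_profile p C R g b H q" using profile g by blast
    then interpret radial_profile p C R g b H q .
    have "w x = H (x \<bullet> x)" if "solves_DP i p C R g w" for w :: "real^'n \<Rightarrow> real"
      using solution_le_radial[OF i that x] radial_le_solution[OF i that x]
      by (rule antisym)
    from this[OF uv(1)] this[OF uv(2)] show ?thesis by simp
  qed
  have "0 \<le> \<gamma>" using \<open>\<gamma> > 0\<close> by simp
  show ?thesis
    using exists_iff[of 0] exists_iff[OF \<open>0 \<le> \<gamma>\<close>] unique[of 0] unique[OF \<open>0 \<le> \<gamma>\<close>] by simp
qed

end
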